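(* There is a deterministic protocol for the ad-hoc radio network model (defined in the context) such that, for every directed graph $G$ (not necessarily acyclic or strongly connected) with $n$ vertices, labels from $\{0,1,\dots,n-1\}$, and a designated target node $t$ reachable from all other nodes, the protocol completes information gathering on $G$ within $O(n^{1.5}\log^3 n)$ time steps.
   Context: Ad-hoc radio network model: the network is a directed graph $G$ on $n$ nodes, each node having a distinct label from $\{0,1,\dots,n-1\}$; nodes know $n$ and their own label, but the topology of $G$ is unknown to them. Time proceeds in synchronous discrete steps $0,1,2,\dots$, and all nodes start the protocol simultaneously at step $0$. In each step each node is either transmitting (sending one message) or receiving. If node $u$ transmits in a step, the message reaches all out-neighbors of $u$; a receiving node $v$ receives a message in that step if and only if exactly one in-neighbor of $v$ transmits in that step; if two or more in-neighbors transmit, $v$ receives nothing and cannot distinguish this from silence (no collision detection). A transmitting node gets no feedback about whether its transmission was received. Messages have unbounded size. A deterministic protocol specifies, for each node, whether and what to transmit at each step as a function of its label, $n$, and the messages it has received so far. Information gathering: each node initially holds a unique piece of information (its rumor); there is a designated target node $t$ reachable by directed paths from all nodes; the task is completed when $t$ holds all $n$ rumors. The running time is the number of steps until completion, in the worst case over all such graphs and labelings. *)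

theory Defs
  imports Complex_Main "HOL-Library.Landau_Symbols"
begin

text \<open>
  Nodes are identified with their labels, so a network on \<open>n\<close> nodes is an edge relation
  \<open>E \<subseteq> {..<n} \<times> {..<n}\<close>, where \<open>(u, v) \<in> E\<close> means that transmissions of \<open>u\<close> reach \<open>v\<close>.
  The rumor that \<open>v\<close> holds initially is also named by \<open>v\<close>.

  A message carries a set of rumors and further data of unbounded finite size, coded as a
  natural number.
\<close>

datatype message = Message (rumors: "nat set") (content: nat)

text \<open>
  What a node has heard: one entry per elapsed step, the entry being \<open>None\<close> if nothing was
  received in that step. The length of the list is therefore the number of the current step.
\<close>

type_synonym history = "message option list"

text \<open>
  \<open>P n v h\<close> is the action of the node with label \<open>v\<close> in step \<open>length h\<close>:
  \<open>Some m\<close> is to transmit \<open>m\<close>, and \<open>None\<close> is to be in the receiving state.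
\<close>

type_synonym protocol = "nat \<Rightarrow> nat \<Rightarrow> history \<Rightarrow> message option"

definition held_rumors :: "nat \<Rightarrow> history \<Rightarrow> nat set" where
  "held_rumors v h = insert v (\<Union>m \<in> {m. Some m \<in> set h}. rumors m)"

text \<open>A node cannot put a rumor into a message unless it holds that rumor.\<close>

definition valid_protocol :: "protocol \<Rightarrow> bool" where
  "valid_protocol P \<longleftrightarrow>
     (\<forall>n v h m. P n v h = Some m \<longrightarrow> rumors m \<subseteq> held_rumors v h)"

definition transmitting_in_neighbors ::
    "(nat \<times> nat) set \<Rightarrow> (nat \<Rightarrow> message option) \<Rightarrow> nat \<Rightarrow> nat set" where
  "transmitting_in_neighbors E act v = {u. (u, v) \<in> E \<and> act u \<noteq> None}"

text \<open>
  The outcome of one step for node \<open>v\<close>, where \<open>act\<close> gives the actions of all nodes. Silence,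
  collision and being in the transmitting state all give \<open>None\<close>.
\<close>

definition reception ::
    "(nat \<times> nat) set \<Rightarrow> (nat \<Rightarrow> message option) \<Rightarrow> nat \<Rightarrow> message option" where
  "reception E act v =
     (if act v = None \<and> (\<exists>!u. u \<in> transmitting_in_neighbors E act v)
      then act (THE u. u \<in> transmitting_in_neighbors E act v)
      else None)"

text \<open>\<open>run P n E s v\<close> is the history of node \<open>v\<close> after the steps \<open>0, \<dots>, s - 1\<close>.\<close>

primrec run :: "protocol \<Rightarrow> nat \<Rightarrow> (nat \<times> nat) set \<Rightarrow> nat \<Rightarrow> nat \<Rightarrow> history" where
  "run P n E 0 = (\<lambda>v. [])"
| "run P n E (Suc s) =
     (\<lambda>v. run P n E s v @ [reception E (\<lambda>u. P n u (run P n E s u)) v])"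

definition gathering_completed ::
    "protocol \<Rightarrow> nat \<Rightarrow> (nat \<times> nat) set \<Rightarrow> nat \<Rightarrow> nat \<Rightarrow> bool" where
  "gathering_completed P n E t s \<longleftrightarrow> {..<n} \<subseteq> held_rumors t (run P n E s t)"

end

theory Submission
  imports Defs "HOL-Library.FuncSet" "HOL-Library.Countable" "HOL-Library.Discrete_Functions"
    "HOL-Real_Asymp.Real_Asymp"
begin

text \<open>
  After one round robin every node knows its in-neighbors. From then on messages carry all
  in-neighborhoods that the sender knows, so that a node can recognize that it knows all of its
  ancestors; call it complete from then on. Three kinds of channels are time-multiplexed:
  \<^item> complete nodes transmit in a perpetual round robin;
  \<^item> for each \<open>k = 2 ^ a\<close>, complete nodes run once through a strongly \<open>k\<close>-selective family of
    length \<open>m = O(k\<^sup>2 log n)\<close> and then fall silent;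
  \<^item> for each size \<open>s = 2 ^ j\<close>, the incomplete nodes repeat a gossiping block that succeeds on
    every strongly connected component of size at most \<open>s\<close> whose external in-neighbors are silent,
    and that takes \<open>O(s sqrt n log\<^sup>2 n)\<close> slots.

  Consider a step in which the target is incomplete, and a first strongly connected component (in
  the order of reachability) with an incomplete node. Either some edge from a complete to an
  incomplete node has not yet delivered, or the component is gossiping undisturbed. In the first
  case, let \<open>m\<close> be the length of the longest family that has failed on this edge; it failed
  because some \<open>k\<close> other nodes completed within \<open>O(m)\<close> slots of the current step. Each node can be
  blamed for \<open>O(m)\<close> slots only, so there are \<open>O(n m / k) = O(n k log n)\<close> such slots, where
  \<open>k \<le> sqrt n\<close> due to the round robin. In the second case the component accounts for at most two
  blocks, and the lengths of the blocks add up to \<open>O(n sqrt n log\<^sup>2 n)\<close> over all components.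

  Gossiping inside a component of size at most \<open>s\<close>: after \<open>r\<close> round robins, with
  \<open>r \<approx> s log\<^sup>2 n / sqrt n\<close>, each item of knowledge is held by more than \<open>r\<close> nodes or by all of
  them. Then, repeatedly, the node with the most knowledge is elected by binary search and broadcasts
  what it knows, which multiplies the number of items not yet known to all by at most \<open>1 - (r + 1) / s\<close>.
  A broadcast takes \<open>O(s log\<^sup>2 n)\<close> steps.
\<close>

section \<open>Counting and greedy covering\<close>

lemma double_counting:
  assumes "finite A" "finite B"
  shows "(\<Sum>a\<in>A. card {b\<in>B. r a b}) = (\<Sum>b\<in>B. card {a\<in>A. r a b})"
proof -
  have "(\<Sum>a\<in>A. card {b\<in>B. r a b}) = (\<Sum>a\<in>A. \<Sum>b\<in>B. if r a b then 1 else 0)"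
    using assms by (simp add: sum.If_cases Int_def)
  also have "\<dots> = (\<Sum>b\<in>B. \<Sum>a\<in>A. if r a b then 1 else 0)"
    by (rule sum.swap)
  also have "\<dots> = (\<Sum>b\<in>B. card {a\<in>A. r a b})"
    using assms by (simp add: sum.If_cases Int_def)
  finally show ?thesis .
qed

text \<open>By averaging, some single choice satisfies at least a fraction \<open>c\<close> of the
  requirements still open, so each greedy choice leaves at most a fraction \<open>1 - c\<close>.
  Once the bound drops below 1, nothing is left: this is the probabilistic method by
  counting.\<close>

lemma greedy_cover:
  fixes \<Omega> :: "'a set" and R :: "'b set" and c :: real
  assumes fin: "finite \<Omega>" "finite R" and ne: "\<Omega> \<noteq> {}" and c: "0 \<le> c" "c \<le> 1"
    and dense: "\<And>\<rho>. \<rho> \<in> R \<Longrightarrow> c * card \<Omega> \<le> card {\<omega>\<in>\<Omega>. sat \<omega> \<rho>}"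
  shows "\<exists>F :: nat \<Rightarrow> 'a. card {\<rho>\<in>R. \<forall>i<m. \<not> sat (F i) \<rho>} \<le> (1 - c) ^ m * card R"
proof (induction m)
  case 0
  then show ?case by simp
next
  case (Suc m)
  then obtain F :: "nat \<Rightarrow> 'a" where F: "card {\<rho>\<in>R. \<forall>i<m. \<not> sat (F i) \<rho>} \<le> (1 - c) ^ m * card R"
    by blast
  define U where "U = {\<rho>\<in>R. \<forall>i<m. \<not> sat (F i) \<rho>}"
  have finU: "finite U" using fin by (simp add: U_def)
  have "\<exists>\<omega>\<in>\<Omega>. c * card U \<le> card {\<rho>\<in>U. sat \<omega> \<rho>}"
  proof (rule ccontr)
    assume "\<not> ?thesis"
    then have "(\<Sum>\<omega>\<in>\<Omega>. real (card {\<rho>\<in>U. sat \<omega> \<rho>})) < (\<Sum>\<omega>\<in>\<Omega>. c * card U)"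
      using fin ne by (intro sum_strict_mono) (auto simp: not_le)
    also have "\<dots> = (\<Sum>\<rho>\<in>U. c * card \<Omega>)"
      by simp
    also have "\<dots> \<le> (\<Sum>\<rho>\<in>U. real (card {\<omega>\<in>\<Omega>. sat \<omega> \<rho>}))"
      by (rule sum_mono) (auto intro!: dense simp: U_def)
    also have "\<dots> = (\<Sum>\<omega>\<in>\<Omega>. real (card {\<rho>\<in>U. sat \<omega> \<rho>}))"
      using double_counting[OF fin(1) finU, of sat] by (simp flip: of_nat_sum)
    finally show False by simp
  qed
  then obtain \<omega> where \<omega>: "c * card U \<le> card {\<rho>\<in>U. sat \<omega> \<rho>}" by blast
  have "{\<rho>\<in>R. \<forall>i<Suc m. \<not> sat ((F(m := \<omega>)) i) \<rho>} = U - {\<rho>\<in>U. sat \<omega> \<rho>}"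
    by (auto simp: U_def less_Suc_eq)
  moreover have "real (card (U - {\<rho>\<in>U. sat \<omega> \<rho>})) = card U - real (card {\<rho>\<in>U. sat \<omega> \<rho>})"
    using finU by (subst card_Diff_subset) (auto simp: card_mono of_nat_diff)
  moreover have "card U - real (card {\<rho>\<in>U. sat \<omega> \<rho>}) \<le> (1 - c) * card U"
    using \<omega> by (simp add: algebra_simps)
  moreover have "(1 - c) * card U \<le> (1 - c) * ((1 - c) ^ m * card R)"
    using F c by (intro mult_left_mono) (auto simp: U_def)
  ultimately show ?case by (intro exI[of _ "F(m := \<omega>)"]) simp
qed

section \<open>Selective families\<close>

text \<open>\<open>X\<close> consists of transmitters one of which has to get through,
  \<open>Y\<close> of interferers. With \<open>q = 1\<close>, a singleton \<open>X\<close> isolates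
  a prescribed node (strong selectivity); with \<open>q\<close> proportional to \<open>k\<close>, a
  length of order \<open>k * lg n\<close> suffices.\<close>

definition selective :: "nat \<Rightarrow> nat \<Rightarrow> nat \<Rightarrow> nat \<Rightarrow> (nat \<Rightarrow> nat set) \<Rightarrow> bool" where
  "selective n k q m F \<longleftrightarrow>
     (\<forall>X Y. X \<subseteq> {..<n} \<and> Y \<subseteq> {..<n} \<and> X \<inter> Y = {} \<and> q \<le> card X \<and> card X + card Y \<le> k \<longrightarrow>
        (\<exists>i<m. \<exists>x\<in>X. F i \<inter> (X \<union> Y) = {x}))"

definition lg :: "nat \<Rightarrow> nat" where "lg n = Suc (floor_log n)"

lemma lg_pos: "0 < lg n" by (simp add: lg_def)

lemma less_two_power_lg: "n < 2 ^ lg n"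
  by (simp add: lg_def floor_log_exp2_gt)

text \<open>A set is listed and padded with the dummy \<open>n\<close> to length \<open>k\<close>,
  so words of length \<open>k\<close> over \<open>n + 1\<close> symbols cover all sets.\<close>

lemma card_small_subsets_le: "card {X. X \<subseteq> {..<n} \<and> card X \<le> k} \<le> 2 ^ (lg n * k)"
proof -
  let ?ls = "{xs. set xs \<subseteq> {..n} \<and> length xs = k}"
  have "{X. X \<subseteq> {..<n} \<and> card X \<le> k} \<subseteq> (\<lambda>xs. set xs - {n}) ` ?ls"
  proof
    fix X assume "X \<in> {X. X \<subseteq> {..<n} \<and> card X \<le> k}"
    then have X: "X \<subseteq> {..<n}" "card X \<le> k" by auto
    then have "finite X" using finite_subset by blast
    then obtain xs where xs: "set xs = X" "distinct xs" using finite_distinct_list by blast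
    then have "length xs \<le> k" using X distinct_card by fastforce
    then have "xs @ replicate (k - length xs) n \<in> ?ls" using X xs by (auto split: if_splits)
    moreover have "X = set (xs @ replicate (k - length xs) n) - {n}" using X xs by auto
    ultimately show "X \<in> (\<lambda>xs. set xs - {n}) ` ?ls" by blast
  qed
  then have "card {X. X \<subseteq> {..<n} \<and> card X \<le> k} \<le> card ?ls"
    by (intro surj_card_le finite_lists_length_eq) auto
  also have "\<dots> = (n + 1) ^ k" by (simp add: card_lists_length_eq)
  also have "\<dots> \<le> (2 ^ lg n) ^ k"
    using less_two_power_lg[of n] by (intro power_mono) auto
  finally show ?thesis by (simp add: power_mult)
qed

text \<open>Each label joins a random set with probability \<open>1 / (2 * k)\<close>, modelled by
  \<open>f i = 0\<close>. A fixed \<open>x\<close> is the only chosen member of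
  \<open>X \<union> Y\<close> with probability at least \<open>1 / (4 * k)\<close>, and these events
  are disjoint for different \<open>x\<close>, so their probabilities add up.\<close>

lemma random_set_isolates:
  fixes n k :: nat
  assumes XY: "X \<subseteq> {..<n}" "Y \<subseteq> {..<n}" "X \<inter> Y = {}" "card X + card Y \<le> k" "1 \<le> card X"
  defines "\<Omega> \<equiv> {..<n} \<rightarrow>\<^sub>E {..<2 * k}"
  shows "real (card X) / (4 * k) * card \<Omega> \<le>
    card {f\<in>\<Omega>. \<exists>x\<in>X. {i. i < n \<and> f i = 0} \<inter> (X \<union> Y) = {x}}"
proof -
  define N where "N = 2 * k"
  have k: "1 \<le> k" using XY by linarith
  define W where "W = X \<union> Y"
  define w where "w = card W"
  have fin: "finite X" "finite Y" using finite_subset[OF XY(1)] finite_subset[OF XY(2)] by simp_all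
  have w: "w = card X + card Y" using XY fin by (simp add: w_def W_def card_Un_disjoint)
  have W: "W \<subseteq> {..<n}" "finite W" using XY fin by (auto simp: W_def)
  have wn: "w \<le> n" using card_mono[OF _ W(1)] by (simp add: w_def)
  define G where "G x = PiE {..<n} (\<lambda>i. if i = x then {0} else if i \<in> W then {1..<N} else {..<N})" for x
  have cardG: "card (G x) = (N - 1) ^ (w - 1) * N ^ (n - w)" if "x \<in> X" for x
  proof -
    have x: "x \<in> W" "x < n" using that W by (auto simp: W_def)
    have "card (G x) = (\<Prod>i<n. if i = x then 1 else if i \<in> W then N - 1 else N)"
      unfolding G_def by (subst card_PiE) (auto intro!: prod.cong)
    also have "{..<n} = insert x ((W - {x}) \<union> ({..<n} - W))" using W x by auto
    also have "(\<Prod>i\<in>insert x ((W - {x}) \<union> ({..<n} - W)). if i = x then 1 else if i \<in> W then N - 1 else N)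
       = (\<Prod>i\<in>(W - {x}) \<union> ({..<n} - W). if i = x then 1 else if i \<in> W then N - 1 else N)"
      using W x by (subst prod.insert) auto
    also have "\<dots> = (\<Prod>i\<in>W - {x}. N - 1) * (\<Prod>i\<in>{..<n} - W. N)"
    proof (subst prod.union_disjoint)
      show "(\<Prod>i\<in>W - {x}. if i = x then 1 else if i \<in> W then N - 1 else N) *
          (\<Prod>i\<in>{..<n} - W. if i = x then 1 else if i \<in> W then N - 1 else N) =
        (\<Prod>i\<in>W - {x}. N - 1) * (\<Prod>i\<in>{..<n} - W. N)"
        using x by (intro arg_cong2[where f = "(*)"] prod.cong) auto
    qed (use W in auto)
    finally show ?thesis using W x by (simp add: w_def card_Diff_subset)
  qed
  have sub: "(\<Union>x\<in>X. G x) \<subseteq> {f\<in>\<Omega>. \<exists>x\<in>X. {i. i < n \<and> f i = 0} \<inter> (X \<union> Y) = {x}}"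
  proof safe
    fix x f assume x: "x \<in> X" and f: "f \<in> G x"
    have xn: "x < n" using x XY by auto
    have val: "f i \<in> (if i = x then {0} else if i \<in> W then {1..<N} else {..<N})" if "i < n" for i
      using f that unfolding G_def by (auto simp: PiE_def Pi_def)
    have "f i < 2 * k" if "i < n" for i using val[OF that] k by (auto simp: N_def split: if_splits)
    then show "f \<in> \<Omega>" using f unfolding \<Omega>_def G_def by (auto simp: PiE_def)
    have "{i. i < n \<and> f i = 0} \<inter> (X \<union> Y) = {x}"
    proof -
      have "f i \<noteq> 0" if "i \<in> W" "i \<noteq> x" for i using val[of i] that W by auto
      moreover have "f x = 0" using val[OF xn] by simp
      ultimately show ?thesis using x xn unfolding W_def by blast
    qed
    then show "\<exists>x\<in>X. {i. i < n \<and> f i = 0} \<inter> (X \<union> Y) = {x}" using x by blast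
  qed
  have disj: "G x \<inter> G y = {}" if "x \<in> X" "y \<in> X" "x \<noteq> y" for x y
  proof -
    have False if f: "f \<in> G x" "f \<in> G y" for f
    proof -
      have xn: "x < n" using \<open>x \<in> X\<close> XY by auto
      have "f x \<in> {0}" using f(1) xn unfolding G_def by (auto simp: PiE_def Pi_def)
      moreover have "f x \<in> {1..<N}"
        using f(2) xn \<open>x \<noteq> y\<close> \<open>x \<in> X\<close> unfolding G_def W_def by (auto simp: PiE_def Pi_def)
      ultimately show False by simp
    qed
    then show ?thesis by blast
  qed
  have finG: "finite (G x)" for x unfolding G_def by (intro finite_PiE) auto
  have fin\<Omega>: "finite \<Omega>" unfolding \<Omega>_def by (intro finite_PiE) auto
  have "card X * ((N - 1) ^ (w - 1) * N ^ (n - w)) = card (\<Union>x\<in>X. G x)"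
    using fin finG disj cardG by (subst card_UN_disjoint) auto
  also have "\<dots> \<le> card {f\<in>\<Omega>. \<exists>x\<in>X. {i. i < n \<and> f i = 0} \<inter> (X \<union> Y) = {x}}"
    using fin\<Omega> by (intro card_mono[OF _ sub]) auto
  finally have low: "card X * ((N - 1) ^ (w - 1) * N ^ (n - w)) \<le>
     card {f\<in>\<Omega>. \<exists>x\<in>X. {i. i < n \<and> f i = 0} \<inter> (X \<union> Y) = {x}}" .
  have N: "1 \<le> N" using k by (simp add: N_def)
  \<comment> \<open>At most \<open>k\<close> labels are involved and \<open>N = 2 * k\<close>, so
    avoiding 0 on the other \<open>w - 1\<close> labels costs at most a factor of two.\<close>
  have "1 / 2 \<le> 1 + real (w - 1) * (- 1 / N)"
    using w XY k by (simp add: N_def field_simps)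
  also have "\<dots> \<le> (1 + (- 1 / N)) ^ (w - 1)"
    using N by (intro Bernoulli_inequality) (simp add: field_simps)
  also have "1 + (- 1 / N) = real (N - 1) / N"
    using N by (simp add: field_simps of_nat_diff)
  finally have half: "real N ^ (w - 1) \<le> 2 * real (N - 1) ^ (w - 1)"
    using N by (simp add: power_divide field_simps)
  have card\<Omega>: "card \<Omega> = N ^ n" by (simp add: \<Omega>_def N_def card_PiE)
  have "n = Suc (w - 1) + (n - w)" using w XY wn by simp
  then have "real N ^ n = real N * real N ^ (w - 1) * real N ^ (n - w)"
    by (metis power_Suc power_add)
  also have "\<dots> \<le> real N * (2 * real (N - 1) ^ (w - 1)) * real N ^ (n - w)"
    using half by (intro mult_right_mono mult_left_mono) auto
  finally have "real (card X) / (4 * k) * real N ^ n \<le>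
      real (card X) / (4 * k) * (real N * (2 * real (N - 1) ^ (w - 1)) * real N ^ (n - w))"
    by (intro mult_left_mono) auto
  also have "\<dots> = real (card X * ((N - 1) ^ (w - 1) * N ^ (n - w)))"
    using k by (simp add: N_def field_simps)
  also have "\<dots> \<le> card {f\<in>\<Omega>. \<exists>x\<in>X. {i. i < n \<and> f i = 0} \<inter> (X \<union> Y) = {x}}"
    using low of_nat_le_iff by blast
  finally show ?thesis by (simp add: card\<Omega>)
qed

text \<open>At most \<open>2 ^ (2 * lg n * k)\<close> pairs \<open>(X, Y)\<close> have to be served,
  and the hypothesis on \<open>m\<close> makes the greedy choice shrink their number by
  \<open>exp (- (2 * lg n * k))\<close>. As \<open>2 < exp 1\<close>, fewer than one pair
  remains.\<close>

theorem ex_selective: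
  assumes q: "1 \<le> q" and m: "8 * lg n * k\<^sup>2 \<le> m * q"
  shows "\<exists>F. selective n k q m F"
proof (cases "q \<le> k")
  case False
  then show ?thesis by (auto simp: selective_def)
next
  case True
  then have k: "1 \<le> k" using q by simp
  define \<Omega> where "\<Omega> = {..<n} \<rightarrow>\<^sub>E {..<2 * k}"
  define S where "S = {X. X \<subseteq> {..<n} \<and> card X \<le> k}"
  define R where "R = {(X, Y). X \<in> S \<and> Y \<in> S \<and> X \<inter> Y = {} \<and> q \<le> card X \<and> card X + card Y \<le> k}"
  define sat where "sat f \<rho> \<longleftrightarrow> (\<exists>x\<in>fst \<rho>. {i. i < n \<and> f i = 0} \<inter> (fst \<rho> \<union> snd \<rho>) = {x})"
    for f :: "nat \<Rightarrow> nat" and \<rho>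
  define c where "c = real q / (4 * k)"
  have finS: "finite S" unfolding S_def by (rule finite_subset[of _ "Pow {..<n}"]) auto
  have RS: "R \<subseteq> S \<times> S" by (auto simp: R_def)
  then have finR: "finite R" using finS finite_subset by blast
  have cR: "card R \<le> 2 ^ (2 * lg n * k)"
  proof -
    have "card R \<le> card S * card S"
      using card_mono[OF _ RS] finS by (simp add: card_cartesian_product)
    also have "\<dots> \<le> 2 ^ (lg n * k) * 2 ^ (lg n * k)"
      unfolding S_def by (intro mult_mono card_small_subsets_le) auto
    finally show ?thesis by (simp add: power_add[symmetric] mult_2 add_mult_distrib)
  qed
  have "\<exists>F. real (card {\<rho>\<in>R. \<forall>i<m. \<not> sat (F i) \<rho>}) \<le> (1 - c) ^ m * card R"
  proof (rule greedy_cover)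
    show "finite \<Omega>" unfolding \<Omega>_def by (intro finite_PiE) auto
    have "0 \<in> {..<2 * k}" using k by simp
    then show "\<Omega> \<noteq> {}" unfolding \<Omega>_def PiE_eq_empty_iff by blast
    show "0 \<le> c" "c \<le> 1" using k True by (auto simp: c_def field_simps)
    fix \<rho> assume \<rho>: "\<rho> \<in> R"
    obtain X Y where XY: "\<rho> = (X, Y)" by force
    have "c * card \<Omega> \<le> real (card X) / (4 * k) * card \<Omega>"
      using \<rho> XY by (intro mult_right_mono) (auto simp: c_def R_def divide_right_mono)
    also have "\<dots> \<le> card {f\<in>\<Omega>. sat f \<rho>}"
      unfolding sat_def \<Omega>_def XY fst_conv snd_conv
      by (rule random_set_isolates) (use \<rho> XY q in \<open>auto simp: R_def S_def\<close>)
    finally show "c * card \<Omega> \<le> card {f\<in>\<Omega>. sat f \<rho>}" .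
  qed (fact finR)
  then obtain F where F: "real (card {\<rho>\<in>R. \<forall>i<m. \<not> sat (F i) \<rho>}) \<le> (1 - c) ^ m * card R" by blast
  have "(1 - c) ^ m * card R < 1"
  proof -
    have "0 \<le> 1 - c" using k True by (auto simp: c_def field_simps)
    then have "(1 - c) ^ m \<le> exp (- c) ^ m"
      using exp_ge_add_one_self[of "- c"] by (intro power_mono) auto
    also have "\<dots> = exp (- (c * m))" by (simp add: exp_of_nat_mult[symmetric] mult.commute)
    also have "2 * lg n * k \<le> c * m"
    proof -
      have "real (8 * lg n * k\<^sup>2) \<le> real (m * q)" using m of_nat_le_iff by blast
      then show ?thesis using k by (simp add: c_def field_simps power2_eq_square)
    qed
    then have "exp (- (c * m)) \<le> exp (- real (2 * lg n * k))" by simp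
    finally have "(1 - c) ^ m * card R \<le> exp (- real (2 * lg n * k)) * 2 ^ (2 * lg n * k)"
      using cR by (intro mult_mono) (auto simp flip: of_nat_le_iff)
    also have "\<dots> = (2 / exp 1) ^ (2 * lg n * k)"
      using exp_of_nat_mult[of "2 * lg n * k" "1::real"] by (simp add: exp_minus power_divide divide_inverse power_inverse)
    also have "\<dots> < 1"
    proof -
      have "2 < exp (1::real)" using exp_ge_one_plus_x_over_n_power_n[of 2 "1::real"]
        by (simp add: power2_eq_square)
      then have "2 / exp (1::real) < 1" by simp
      then show ?thesis
        using power_strict_mono[of "2 / exp (1::real)" 1 "2 * lg n * k"] k lg_pos[of n] by simp
    qed
    finally show ?thesis .
  qed
  with F have "card {\<rho>\<in>R. \<forall>i<m. \<not> sat (F i) \<rho>} = 0" by linarith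
  then have "{\<rho>\<in>R. \<forall>i<m. \<not> sat (F i) \<rho>} = {}" using finR by simp
  then have all: "\<exists>i<m. sat (F i) (X, Y)" if "(X, Y) \<in> R" for X Y using that by blast
  have "selective n k q m (\<lambda>i. {v. v < n \<and> F i v = 0})"
    unfolding selective_def
  proof (intro allI impI)
    fix X Y assume *: "X \<subseteq> {..<n} \<and> Y \<subseteq> {..<n} \<and> X \<inter> Y = {} \<and> q \<le> card X \<and> card X + card Y \<le> k"
    then have "(X, Y) \<in> R" by (auto simp: R_def S_def)
    from all[OF this] show "\<exists>i<m. \<exists>x\<in>X. {v. v < n \<and> F i v = 0} \<inter> (X \<union> Y) = {x}"
      by (auto simp: sat_def)
  qed
  then show ?thesis by blast
qed

text \<open>A channel and a position in a schedule of period \<open>m\<close> together amount to a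
  residue modulo \<open>c * m\<close>, so a window of that many steps meets each such pair wherever
  the window starts.\<close>

lemma window_hits_slot:
  fixes c m :: nat
  assumes "a < c" "e < m"
  shows "\<exists>\<tau>. s \<le> \<tau> \<and> \<tau> < s + c * m \<and> \<tau> mod c = a \<and> (\<tau> div c) mod m = e"
proof -
  define N where "N = c * m"
  define y where "y = c * e + a"
  have "c * e + c \<le> c * m" using assms(2) by (metis Suc_leI mult_Suc_right mult_le_mono2 add.commute)
  then have y: "y < N" using assms by (simp add: y_def N_def)
  \<comment> \<open>This is the first step from \<open>s\<close> on with residue \<open>y\<close>
    modulo \<open>N\<close>.\<close>
  define \<tau> where "\<tau> = s + (y + (N - s mod N)) mod N"
  have "\<tau> mod N = (s mod N + (y + (N - s mod N))) mod N"
    by (simp add: \<tau>_def mod_simps)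
  also have "s mod N + (y + (N - s mod N)) = y + N"
    using mod_less_divisor[of N s] y by linarith
  finally have \<tau>: "\<tau> mod N = y" using y by simp
  have "\<tau> < s + N" using y by (simp add: \<tau>_def)
  moreover have "c * ((\<tau> div c) mod m) + \<tau> mod c = c * e + a"
    using \<tau> by (simp add: N_def y_def mod_mult2_eq)
  moreover have "\<tau> mod c < c" using assms by simp
  moreover have "\<tau> mod c = (c * ((\<tau> div c) mod m) + \<tau> mod c) mod c" by simp
  ultimately have "\<tau> mod c = a" using assms by (metis mod_less mod_mult_self4)
  with \<open>c * ((\<tau> div c) mod m) + \<tau> mod c = c * e + a\<close> have "(\<tau> div c) mod m = e"
    using assms by simp
  then show ?thesis using \<open>\<tau> mod c = a\<close> \<open>\<tau> < s + N\<close> by (intro exI[of _ \<tau>]) (simp add: N_def \<tau>_def)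
qed

section \<open>Broadcasting in a strongly connected component\<close>

text \<open>
  If all nodes of \<open>A\<close> reach each other within \<open>A\<close>, the distance to \<open>x\<close> serves as \<open>d\<close>.
\<close>

definition strongly_connected_on :: "(nat \<times> nat) set \<Rightarrow> nat set \<Rightarrow> bool" where
  "strongly_connected_on E A \<longleftrightarrow>
     (\<forall>x\<in>A. \<exists>d :: nat \<Rightarrow> nat. \<forall>u\<in>A. u \<noteq> x \<longrightarrow> (\<exists>w\<in>A. (u, w) \<in> E \<and> d w < d u))"

text \<open>Following edges that decrease \<open>d\<close> from \<open>u\<close> must leave
  \<open>R\<close> before \<open>x\<close> is reached, and the head of the leaving edge is closer
  than \<open>u\<close>.\<close>

lemma descent_edge:
  fixes d :: "nat \<Rightarrow> nat"
  assumes d: "\<forall>u\<in>A. u \<noteq> x \<longrightarrow> (\<exists>w\<in>A. (u, w) \<in> E \<and> d w < d u)"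
    and R: "R \<subseteq> A" "u \<in> R" "x \<notin> R"
  shows "\<exists>u'\<in>R. \<exists>w\<in>A - R. (u', w) \<in> E \<and> d w < d u"
  using R(2)
proof (induction "d u" arbitrary: u rule: less_induct)
  case less
  have "u \<noteq> x" "u \<in> A" using less(2) R by auto
  with d obtain w where w: "w \<in> A" "(u, w) \<in> E" "d w < d u" by blast
  show ?case
  proof (cases "w \<in> R")
    case True
    from less(1)[OF w(3) this] obtain u' w' where "u' \<in> R" "w' \<in> A - R" "(u', w') \<in> E" "d w' < d w"
      by (elim bexE conjE)
    with w(3) show ?thesis by (intro bexI[of _ u'] bexI[of _ w']) auto
  next
    case False
    with w less(2) show ?thesis by (intro bexI[of _ u] bexI[of _ w]) auto
  qed
qed

lemma strongly_connected_on_leaving_edge: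
  assumes "strongly_connected_on E A" "R \<subseteq> A" "R \<noteq> {}" "R \<noteq> A"
  shows "\<exists>u\<in>R. \<exists>w\<in>A - R. (u, w) \<in> E"
proof -
  obtain x where x: "x \<in> A" "x \<notin> R" using assms by blast
  obtain u where u: "u \<in> R" using assms by blast
  obtain d :: "nat \<Rightarrow> nat" where "\<forall>u\<in>A. u \<noteq> x \<longrightarrow> (\<exists>w\<in>A. (u, w) \<in> E \<and> d w < d u)"
    using assms x unfolding strongly_connected_on_def by blast
  from descent_edge[OF this assms(2) u x(2)] show ?thesis by blast
qed

text \<open>This is the length that \<open>ex_selective\<close> asks for with
  \<open>k = 2 ^ (i + 2)\<close> and \<open>q = 2 ^ i\<close>. The factor four leaves room for fewer
  than \<open>2 ^ (i + 1)\<close> old informed in-neighbors and fewer than that many new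
  ones.\<close>

definition bcast_len :: "nat \<Rightarrow> nat \<Rightarrow> nat" where
  "bcast_len n i = 128 * lg n * 2 ^ i"

definition bcast_fam :: "nat \<Rightarrow> nat \<Rightarrow> nat \<Rightarrow> nat set" where
  "bcast_fam n i = (SOME F. selective n (2 ^ (i + 2)) (2 ^ i) (bcast_len n i) F)"

lemma bcast_fam: "selective n (2 ^ (i + 2)) (2 ^ i) (bcast_len n i) (bcast_fam n i)"
  unfolding bcast_fam_def
  by (rule someI_ex[OF ex_selective]) (simp_all add: bcast_len_def power2_eq_square power_add)

text \<open>The number of informed in-neighbors is unknown, so the families of all scales are
  interleaved and repeated; the residue modulo \<open>lg n\<close> selects the scale.\<close>

definition bcast_set :: "nat \<Rightarrow> nat \<Rightarrow> nat set" where
  "bcast_set n \<delta> = bcast_fam n (\<delta> mod lg n) ((\<delta> div lg n) mod bcast_len n (\<delta> mod lg n))"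

text \<open>The factor is \<open>3 * 128\<close>: the potential of the front stays below or at
  \<open>2 * s\<close>, each unit pays for \<open>128 * (lg n)\<^sup>2\<close> steps, and one
  further stage takes at most \<open>s\<close> times as many.\<close>

definition bcast_time :: "nat \<Rightarrow> nat \<Rightarrow> nat" where
  "bcast_time n s = 384 * (lg n)\<^sup>2 * s"

text \<open>
  \<open>I \<delta>\<close> is the set of informed nodes after \<open>\<delta>\<close> steps. The analysis fixes an uninformed node \<open>x\<close>
  and follows the front: the uninformed node with an informed in-neighbor that is closest to \<open>x\<close>.
  In a stage of length proportional to the number \<open>z\<close> of its informed in-neighbors, either the front
  moves closer to \<open>x\<close>, so that these \<open>z\<close> nodes are never again in-neighbors of the front, or
  \<open>z\<close> doubles.
\<close>

locale broadcast =
  fixes n :: nat and E :: "(nat \<times> nat) set" and A :: "nat set" and I :: "nat \<Rightarrow> nat set" and s :: nat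
  assumes A: "A \<subseteq> {..<n}" "card A \<le> s" "strongly_connected_on E A"
    and I0: "I 0 \<noteq> {}" and IA: "I 0 \<subseteq> A"
    and I_Suc: "\<And>\<delta>. \<delta> < bcast_time n s \<Longrightarrow> I (Suc \<delta>) = I \<delta> \<union>
      {v\<in>A. v \<notin> I \<delta> \<inter> bcast_set n \<delta> \<and> (\<exists>!u. u \<in> I \<delta> \<inter> bcast_set n \<delta> \<and> (u, v) \<in> E)}"
begin

lemma informed_mono: "\<delta> \<le> \<delta>' \<Longrightarrow> \<delta>' \<le> bcast_time n s \<Longrightarrow> I \<delta> \<subseteq> I \<delta>'"
proof (induction \<delta>' rule: dec_induct)
  case (step k)
  then show ?case using I_Suc[of k] by auto
qed simp

lemma informed_subset: "\<delta> \<le> bcast_time n s \<Longrightarrow> I \<delta> \<subseteq> A"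
proof (induction \<delta>)
  case (Suc k)
  then show ?case using I_Suc[of k] by auto
qed (simp add: IA)

lemma finite_A: "finite A" using A(1) finite_subset by blast

definition informed_nbrs :: "nat \<Rightarrow> nat \<Rightarrow> nat set" where
  "informed_nbrs \<delta> v = {u \<in> I \<delta>. (u, v) \<in> E}"

text \<open>Such nodes can be in-neighbors neither of the front \<open>v\<close> nor of any later
  front at most as far from \<open>x\<close>.\<close>

definition spent :: "(nat \<Rightarrow> nat) \<Rightarrow> nat \<Rightarrow> nat \<Rightarrow> nat set" where
  "spent d \<delta> v = {u \<in> I \<delta>. \<forall>w\<in>A - I \<delta>. (u, w) \<in> E \<longrightarrow> d v < d w}"

definition front :: "(nat \<Rightarrow> nat) \<Rightarrow> nat \<Rightarrow> nat \<Rightarrow> bool" where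
  "front d \<delta> v \<longleftrightarrow> v \<in> A - I \<delta> \<and> informed_nbrs \<delta> v \<noteq> {} \<and>
     (\<forall>u\<in>I \<delta>. \<forall>w\<in>A - I \<delta>. (u, w) \<in> E \<longrightarrow> d v \<le> d w)"

text \<open>With weight two for spent nodes, a stage gains the number \<open>z\<close> of informed
  in-neighbors in both cases: when the front advances they become spent, and otherwise their number
  doubles.\<close>

definition potential :: "(nat \<Rightarrow> nat) \<Rightarrow> nat \<Rightarrow> nat \<Rightarrow> nat" where
  "potential d \<delta> v = 2 * card (spent d \<delta> v) + card (informed_nbrs \<delta> v)"

lemma ex_front_le:
  assumes "u \<in> I \<delta>" "w \<in> A - I \<delta>" "(u, w) \<in> E"
  shows "\<exists>v. front d \<delta> v \<and> d v \<le> d w"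
proof -
  define P where "P w \<longleftrightarrow> w \<in> A - I \<delta> \<and> (\<exists>u\<in>I \<delta>. (u, w) \<in> E)" for w
  have "P w" using assms by (auto simp: P_def)
  then obtain v where v: "P v" "\<And>y. P y \<Longrightarrow> d v \<le> d y"
    using exists_least_iff[of "\<lambda>k. \<exists>v. P v \<and> d v = k"] by (metis arg_min_natI arg_min_nat_le)
  then have "front d \<delta> v" unfolding front_def informed_nbrs_def P_def by blast
  moreover have "d v \<le> d w" using v \<open>P w\<close> by blast
  ultimately show ?thesis by blast
qed

lemma potential_le:
  assumes "\<delta> \<le> bcast_time n s" "front d \<delta> v"
  shows "potential d \<delta> v \<le> 2 * s"
proof -
  have I: "I \<delta> \<subseteq> A" "finite (I \<delta>)"
    using informed_subset[OF assms(1)] finite_A finite_subset by blast+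
  have "spent d \<delta> v \<inter> informed_nbrs \<delta> v = {}"
    using assms(2) by (auto simp: spent_def informed_nbrs_def front_def)
  moreover have "spent d \<delta> v \<subseteq> I \<delta>" "informed_nbrs \<delta> v \<subseteq> I \<delta>"
    by (auto simp: spent_def informed_nbrs_def)
  ultimately have "card (spent d \<delta> v) + card (informed_nbrs \<delta> v) \<le> card (I \<delta>)"
    using I by (metis card_Un_disjoint card_mono finite_subset le_sup_iff)
  also have "\<dots> \<le> s" using card_mono[OF finite_A I(1)] A by simp
  finally show ?thesis by (simp add: potential_def)
qed

text \<open>Otherwise the old in-neighbors \<open>X\<close> and the newly informed ones
  \<open>Y\<close> number at most \<open>2 ^ (i + 2)\<close> together. The stage runs through the
  whole family of scale \<open>i\<close>, which then isolates a member of \<open>X\<close>, and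
  \<open>v\<close> hears it.\<close>

lemma stage_informs_or_doubles:
  assumes v: "v \<in> A - I \<delta>" and Z: "2 ^ i \<le> card (informed_nbrs \<delta> v)" "card (informed_nbrs \<delta> v) < 2 ^ (i + 1)"
    and \<delta>': "\<delta>' = \<delta> + lg n * bcast_len n i" "\<delta>' \<le> bcast_time n s" and unv: "v \<notin> I \<delta>'"
  shows "2 * card (informed_nbrs \<delta> v) \<le> card (informed_nbrs \<delta>' v)"
proof (rule ccontr)
  assume neg: "\<not> ?thesis"
  define X where "X = informed_nbrs \<delta> v"
  define Y where "Y = informed_nbrs \<delta>' v - X"
  have sub: "X \<subseteq> informed_nbrs \<delta>' v"
    using informed_mono[of \<delta> \<delta>'] \<delta>' by (auto simp: X_def informed_nbrs_def)
  have subn: "informed_nbrs \<delta>' v \<subseteq> {..<n}"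
    using informed_subset[OF \<delta>'(2)] A by (auto simp: informed_nbrs_def)
  then have "finite (informed_nbrs \<delta>' v)" by (rule finite_subset) simp
  then have fin: "finite (informed_nbrs \<delta>' v)" "finite X" using finite_subset[OF sub] by simp_all
  have "card Y = card (informed_nbrs \<delta>' v) - card X"
    unfolding Y_def using fin sub by (intro card_Diff_subset) auto
  then have "card Y < card X" using neg by (simp add: X_def)
  then have "card X + card Y \<le> 2 ^ (i + 2)" using Z by (simp add: X_def)
  moreover have "X \<subseteq> {..<n}" "Y \<subseteq> {..<n}" "X \<inter> Y = {}" using subn sub by (auto simp: Y_def)
  moreover have "2 ^ i \<le> card X" using Z by (simp add: X_def)
  ultimately obtain e x where e: "e < bcast_len n i" "x \<in> X" "bcast_fam n i e \<inter> (X \<union> Y) = {x}"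
    using bcast_fam[of n i] unfolding selective_def by metis
  have "2 ^ i \<le> card {..<n}"
    using Z(1) card_mono[OF _ order_trans[OF sub subn]] by (simp add: X_def)
  then have "(2::nat) ^ i < 2 ^ lg n" using less_two_power_lg[of n] by (simp only: card_lessThan)
  then have "i < lg n" by simp
  from window_hits_slot[OF this e(1), of \<delta>] obtain \<tau> where \<tau>: "\<delta> \<le> \<tau>" "\<tau> < \<delta>'"
    "\<tau> mod lg n = i" "\<tau> div lg n mod bcast_len n i = e" using \<delta>' by auto
  then have G: "bcast_set n \<tau> = bcast_fam n i e" by (simp add: bcast_set_def)
  have mono: "I \<delta> \<subseteq> I \<tau>" "I \<tau> \<subseteq> I \<delta>'" "I (Suc \<tau>) \<subseteq> I \<delta>'"
    using informed_mono \<tau> \<delta>' by auto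
  have "u \<in> I \<tau> \<inter> bcast_set n \<tau> \<and> (u, v) \<in> E \<longleftrightarrow> u = x" for u
  proof
    assume u: "u \<in> I \<tau> \<inter> bcast_set n \<tau> \<and> (u, v) \<in> E"
    then have "u \<in> informed_nbrs \<delta>' v" using mono by (auto simp: informed_nbrs_def)
    then have "u \<in> X \<union> Y" by (auto simp: Y_def)
    then show "u = x" using e u G by blast
  next
    assume "u = x"
    then show "u \<in> I \<tau> \<inter> bcast_set n \<tau> \<and> (u, v) \<in> E"
      using e mono G by (auto simp: X_def informed_nbrs_def)
  qed
  then have "\<exists>!u. u \<in> I \<tau> \<inter> bcast_set n \<tau> \<and> (u, v) \<in> E" by simp
  moreover have "v \<notin> I \<tau>" using unv mono by blast
  ultimately have "v \<in> I (Suc \<tau>)" using I_Suc[of \<tau>] \<tau> \<delta>' v by auto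
  then show False using unv mono by blast
qed

lemma potential_step:
  assumes d: "\<forall>u\<in>A. u \<noteq> x \<longrightarrow> (\<exists>w\<in>A. (u, w) \<in> E \<and> d w < d u)"
    and fr: "front d \<delta> v" and \<delta>: "\<delta> + 128 * (lg n)\<^sup>2 * card (informed_nbrs \<delta> v) \<le> bcast_time n s"
    and x: "x \<notin> I (bcast_time n s)"
  shows "\<exists>\<delta>' v'. front d \<delta>' v' \<and> \<delta>' \<le> \<delta> + 128 * (lg n)\<^sup>2 * card (informed_nbrs \<delta> v) \<and>
    potential d \<delta> v + card (informed_nbrs \<delta> v) \<le> potential d \<delta>' v' \<and> potential d \<delta> v < potential d \<delta>' v'"
proof -
  define z where "z = card (informed_nbrs \<delta> v)"
  have \<delta>D: "\<delta> \<le> bcast_time n s" using \<delta> by simp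
  have finI: "finite (I \<delta>')" if "\<delta>' \<le> bcast_time n s" for \<delta>'
    using informed_subset[OF that] finite_A finite_subset by blast
  have fin: "finite (informed_nbrs \<delta>' w)" "finite (spent d \<delta>' w)" if "\<delta>' \<le> bcast_time n s" for \<delta>' w
    using finI[OF that] by (simp_all add: informed_nbrs_def spent_def)
  have z0: "0 < z" using fr fin[OF \<delta>D] by (simp add: z_def front_def card_gt_0_iff)
  define i where "i = floor_log z"
  have i: "2 ^ i \<le> z" "z < 2 ^ (i + 1)"
    using z0 floor_log_exp2_le[of z] floor_log_exp2_gt[of z] by (simp_all add: i_def)
  define \<delta>' where "\<delta>' = \<delta> + lg n * bcast_len n i"
  have "lg n * bcast_len n i = 128 * (lg n)\<^sup>2 * 2 ^ i" by (simp add: bcast_len_def power2_eq_square)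
  also have "\<dots> \<le> 128 * (lg n)\<^sup>2 * z" using i by simp
  finally have len: "\<delta>' \<le> \<delta> + 128 * (lg n)\<^sup>2 * z" by (simp add: \<delta>'_def)
  then have \<delta>'D: "\<delta>' \<le> bcast_time n s" using \<delta> by (simp add: z_def)
  have mono: "I \<delta> \<subseteq> I \<delta>'" using informed_mono[OF _ \<delta>'D] by (simp add: \<delta>'_def)
  have x': "x \<notin> I \<delta>'" using informed_mono[OF \<delta>'D order_refl] x by blast
  have disj: "spent d \<delta> v \<inter> informed_nbrs \<delta> v = {}"
    using fr by (auto simp: spent_def informed_nbrs_def front_def)
  show ?thesis
  proof (cases "\<exists>u\<in>I \<delta>'. \<exists>w\<in>A - I \<delta>'. (u, w) \<in> E \<and> d w < d v")
    case True
    then obtain v' where v': "front d \<delta>' v'" "d v' < d v" using ex_front_le by (meson le_less_trans)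
    have "spent d \<delta> v \<union> informed_nbrs \<delta> v \<subseteq> spent d \<delta>' v'"
      using mono fr v'(2) unfolding spent_def informed_nbrs_def front_def by fastforce
    then have "card (spent d \<delta> v) + z \<le> card (spent d \<delta>' v')"
      using card_mono[OF fin(2)[OF \<delta>'D]] fin[OF \<delta>D] disj by (metis card_Un_disjoint z_def)
    then have "potential d \<delta> v + z \<le> potential d \<delta>' v'"
      by (simp add: potential_def z_def)
    then show ?thesis using v'(1) len z0 by (intro exI[of _ \<delta>'] exI[of _ v']) (simp add: z_def)
  next
    case False
    \<comment> \<open>If \<open>v\<close> were informed, descent from \<open>v\<close> towards the
      uninformed \<open>x\<close> would give an uninformed node with an informed in-neighbor that is
      closer than \<open>v\<close>.\<close>
    have "v \<notin> I \<delta>'"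
    proof
      assume "v \<in> I \<delta>'"
      from descent_edge[OF d informed_subset[OF \<delta>'D] this x'] show False using False by blast
    qed
    have dbl: "2 * z \<le> card (informed_nbrs \<delta>' v)"
      unfolding z_def
      by (rule stage_informs_or_doubles[where i = i])
        (use fr i \<open>v \<notin> I \<delta>'\<close> \<delta>'D in \<open>auto simp: z_def front_def \<delta>'_def\<close>)
    have "informed_nbrs \<delta>' v \<noteq> {}" using dbl z0 by auto
    then have "front d \<delta>' v" using False fr \<open>v \<notin> I \<delta>'\<close> unfolding front_def by (auto simp: not_less)
    moreover have "spent d \<delta> v \<subseteq> spent d \<delta>' v" using mono by (auto simp: spent_def)
    then have "card (spent d \<delta> v) \<le> card (spent d \<delta>' v)" by (rule card_mono[OF fin(2)[OF \<delta>'D]])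
    then have "potential d \<delta> v + z \<le> potential d \<delta>' v"
      using dbl by (simp add: potential_def z_def)
    ultimately show ?thesis using len z0 by (intro exI[of _ \<delta>'] exI[of _ v]) (simp add: z_def)
  qed
qed

text \<open>If \<open>x\<close> stayed uninformed, stages could be chained without end: the elapsed
  time is charged to the potential, so there is always time for one more, and the potential would
  exceed \<open>2 * s\<close>.\<close>

theorem all_informed: "I (bcast_time n s) = A"
proof (rule ccontr)
  assume "I (bcast_time n s) \<noteq> A"
  then obtain x where x: "x \<in> A" "x \<notin> I (bcast_time n s)" using informed_subset by blast
  then obtain d :: "nat \<Rightarrow> nat" where d: "\<forall>u\<in>A. u \<noteq> x \<longrightarrow> (\<exists>w\<in>A. (u, w) \<in> E \<and> d w < d u)"
    using A(3) unfolding strongly_connected_on_def by blast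
  have x0: "x \<notin> I 0" using informed_mono[of 0] x by auto
  have "\<exists>\<delta> v. front d \<delta> v \<and> N \<le> potential d \<delta> v \<and> \<delta> \<le> 128 * (lg n)\<^sup>2 * potential d \<delta> v \<and> \<delta> \<le> bcast_time n s" for N
  proof (induction N)
    case 0
    obtain u where "u \<in> I 0" using I0 by blast
    from descent_edge[OF d IA this x0] obtain v where "front d 0 v" using ex_front_le by blast
    then show ?case by (intro exI[of _ 0] exI[of _ v]) simp
  next
    case (Suc N)
    then obtain \<delta> v where *: "front d \<delta> v" "N \<le> potential d \<delta> v" "\<delta> \<le> 128 * (lg n)\<^sup>2 * potential d \<delta> v"
      "\<delta> \<le> bcast_time n s" by blast
    define z where "z = card (informed_nbrs \<delta> v)"
    have "informed_nbrs \<delta> v \<subseteq> A" using informed_subset[OF *(4)] by (auto simp: informed_nbrs_def)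
    then have zs: "z \<le> s" using card_mono[OF finite_A, of "informed_nbrs \<delta> v"] A(2) by (simp add: z_def)
    have pot: "potential d \<delta> v \<le> 2 * s" by (rule potential_le[OF *(4,1)])
    have "\<delta> + 128 * (lg n)\<^sup>2 * z \<le> 128 * (lg n)\<^sup>2 * (2 * s) + 128 * (lg n)\<^sup>2 * s"
      using *(3) pot zs by (meson add_mono le_trans mult_le_mono2)
    then have D: "\<delta> + 128 * (lg n)\<^sup>2 * z \<le> bcast_time n s" by (simp add: bcast_time_def mult_ac)
    from potential_step[OF d *(1) D[unfolded z_def] x(2)]
    obtain \<delta>' v' where **: "front d \<delta>' v'" "\<delta>' \<le> \<delta> + 128 * (lg n)\<^sup>2 * z"
      "potential d \<delta> v + z \<le> potential d \<delta>' v'" "potential d \<delta> v < potential d \<delta>' v'"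
      unfolding z_def by blast
    have "\<delta>' \<le> 128 * (lg n)\<^sup>2 * (potential d \<delta> v + z)" using **(2) *(3) by (simp add: add_mult_distrib2)
    also have "\<dots> \<le> 128 * (lg n)\<^sup>2 * potential d \<delta>' v'" using **(3) by simp
    finally show ?case using ** * D by (intro exI[of _ \<delta>'] exI[of _ v']) simp
  qed
  from this[of "2 * s + 1"] show False using potential_le by fastforce
qed

end

definition rt :: "nat \<Rightarrow> nat" where "rt n = Suc (floor_sqrt n)"

section \<open>The protocol\<close>

definition strong_len :: "nat \<Rightarrow> nat \<Rightarrow> nat" where
  "strong_len n a = 8 * lg n * 4 ^ a"

definition strong_fam :: "nat \<Rightarrow> nat \<Rightarrow> nat \<Rightarrow> nat set" where
  "strong_fam n a = (SOME F. selective n (2 ^ a) 1 (strong_len n a) F)"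

lemma strong_fam: "selective n (2 ^ a) 1 (strong_len n a) (strong_fam n a)"
  unfolding strong_fam_def
  by (rule someI_ex[OF ex_selective])
    (simp_all add: strong_len_def power2_eq_square flip: power_mult_distrib)

text \<open>Channel 0 is the round robin, the next \<open>lg n\<close> channels hold the selective
  families, and the last \<open>lg n + 1\<close> hold the gossiping sizes
  \<open>j = 0, ..., lg n\<close>.\<close>

definition channels :: "nat \<Rightarrow> nat" where
  "channels n = 2 * lg n + 2"

text \<open>
  A block for components of size at most \<open>2 ^ j\<close> consists of \<open>rounds n j\<close> round robins and
  \<open>macros n j\<close> elections. An election consists of \<open>key_bits n\<close> broadcasts, one per bit of the
  largest key, starting from the most significant one.
\<close>

definition rounds :: "nat \<Rightarrow> nat \<Rightarrow> nat" where
  "rounds n j = 2 ^ j * (lg n)\<^sup>2 div rt n"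

definition macros :: "nat \<Rightarrow> nat \<Rightarrow> nat" where
  "macros n j = 2 * lg n * (2 ^ j div (rounds n j + 1) + 1)"

definition key_bits :: "nat \<Rightarrow> nat" where
  "key_bits n = 3 * lg n + 1"

definition bct :: "nat \<Rightarrow> nat \<Rightarrow> nat" where
  "bct n j = bcast_time n (2 ^ j)"

definition block :: "nat \<Rightarrow> nat \<Rightarrow> nat" where
  "block n j = rounds n j * n + macros n j * (key_bits n * bct n j)"

text \<open>
  \<open>k\<close> is the offset in a block. During the round robins the truncated subtraction yields the first
  step of the first election, which does no harm as that step recomputes the fields involved.
\<close>

definition bstep :: "nat \<Rightarrow> nat \<Rightarrow> nat \<Rightarrow> nat" where
  "bstep n j k = (k - rounds n j * n) mod bct n j"

definition bphase :: "nat \<Rightarrow> nat \<Rightarrow> nat \<Rightarrow> nat" where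
  "bphase n j k = ((k - rounds n j * n) div bct n j) mod key_bits n"

text \<open>
  A known pair \<open>(u, x)\<close> is an edge, and \<open>(x, x)\<close> means that all edges into \<open>x\<close> are known. The step
  at which the node became complete is stored in \<open>since\<close>. The other fields belong to
  the current block of the gossiping channel \<open>j\<close>: whether the node takes part, its key, the leading
  bits of the largest key found so far, and whether it is informed in the current broadcast.
\<close>

record nstate =
  known :: "(nat \<times> nat) list"
  since :: "nat option"
  joined :: "nat \<Rightarrow> bool"
  key :: "nat \<Rightarrow> nat"
  bits :: "nat \<Rightarrow> nat"
  informed :: "nat \<Rightarrow> bool"

text \<open>Membership is decided once, in the first slot of a block. A node that becomes complete
  during the block keeps its role, so the set of participants stays fixed.\<close>

definition joined_at :: "nat \<Rightarrow> nat \<Rightarrow> nstate \<Rightarrow> bool" where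
  "joined_at j k st = (if k = 0 then since st = None else joined st j)"

text \<open>
  Keys are odd, so the last broadcast of an election has a source, namely the unique node with the
  largest key; this broadcast spreads the knowledge of that node.
\<close>

definition key_at :: "nat \<Rightarrow> nat \<Rightarrow> nat \<Rightarrow> nat \<Rightarrow> nstate \<Rightarrow> nat" where
  "key_at n v j k st =
     (if bstep n j k = 0 \<and> bphase n j k = 0 then 2 * (card (set (known st)) * n + v) + 1 else key st j)"

definition bits_at :: "nat \<Rightarrow> nat \<Rightarrow> nat \<Rightarrow> nstate \<Rightarrow> nat" where
  "bits_at n j k st = (if bstep n j k = 0 \<and> bphase n j k = 0 then 0 else bits st j)"

text \<open>The sources of a broadcast are the nodes whose key continues the bits found so far with
  a 1.\<close>

definition informed_at :: "nat \<Rightarrow> nat \<Rightarrow> nat \<Rightarrow> nat \<Rightarrow> nstate \<Rightarrow> bool" where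
  "informed_at n v j k st =
     (if bstep n j k = 0
      then key_at n v j k st div 2 ^ (key_bits n - 1 - bphase n j k) = 2 * bits_at n j k st + 1
      else informed st j)"

definition gossip_sends :: "nat \<Rightarrow> nat \<Rightarrow> nat \<Rightarrow> nat \<Rightarrow> nstate \<Rightarrow> bool" where
  "gossip_sends n v j k st \<longleftrightarrow> joined_at j k st \<and>
     (if k < rounds n j * n then k mod n = v
      else informed_at n v j k st \<and> v \<in> bcast_set n (bstep n j k))"

text \<open>A bit is appended in the last step of a broadcast: a node informed by then records 1,
  and a node that stayed uninformed records 0.\<close>

definition gossip_update :: "nat \<Rightarrow> nat \<Rightarrow> nat \<Rightarrow> nat \<Rightarrow> bool \<Rightarrow> nstate \<Rightarrow> nstate" where
  "gossip_update n v j k r st = st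
     \<lparr>joined := (joined st)(j := joined_at j k st),
      key := (key st)(j := key_at n v j k st),
      bits := (bits st)(j :=
        (if bstep n j k = bct n j - 1
         then 2 * bits_at n j k st + of_bool (informed_at n v j k st \<or> r) else bits_at n j k st)),
      informed := (informed st)(j := (informed_at n v j k st \<or> r))\<rparr>"

definition chan :: "nat \<Rightarrow> nat \<Rightarrow> nat" where "chan n t = (t - n) mod channels n"
definition slot :: "nat \<Rightarrow> nat \<Rightarrow> nat" where "slot n t = (t - n) div channels n"

text \<open>Positions in a selective family follow the global clock, so a node that becomes complete
  joins in the middle of the family. Its active time is one full period and still covers every
  position.\<close>

definition sends :: "nat \<Rightarrow> nat \<Rightarrow> nat \<Rightarrow> nstate \<Rightarrow> bool" where
  "sends n v t st =
     (if t < n then v = t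
      else if chan n t = 0 then since st \<noteq> None \<and> slot n t mod n = v
      else if chan n t \<le> lg n then
        (let a = chan n t - 1 in
           (\<exists>t0. since st = Some t0 \<and> t < t0 + channels n * strong_len n a) \<and>
           v \<in> strong_fam n a (slot n t mod strong_len n a))
      else
        (let j = chan n t - 1 - lg n in gossip_sends n v j (slot n t mod block n j) st))"

text \<open>Once a mark \<open>(x, x)\<close> implies knowledge of all edges into \<open>x\<close>,
  this condition closes the marked nodes under predecessors.\<close>

definition closed_knowledge :: "(nat \<times> nat) set \<Rightarrow> bool" where
  "closed_knowledge W \<longleftrightarrow> (\<forall>(u, x)\<in>W. (u, u) \<in> W)"

text \<open>In the initial round robin the step number is the sender's label, so any reception
  reveals an edge. The guard \<open>n \<le> Suc t\<close> matters because the initial knowledge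
  \<open>{(v, v)}\<close> already looks closed.\<close>

definition learn :: "nat \<Rightarrow> nat \<Rightarrow> nat \<Rightarrow> (nat \<times> nat) list option \<Rightarrow> nstate \<Rightarrow> nstate" where
  "learn n v t r st =
     (let k = (case r of None \<Rightarrow> known st | Some l \<Rightarrow> if t < n then (t, v) # known st else known st @ l)
      in st \<lparr>known := k,
             since := (if since st \<noteq> None then since st
                       else if n \<le> Suc t \<and> closed_knowledge (set k) then Some (Suc t) else None)\<rparr>)"

definition update :: "nat \<Rightarrow> nat \<Rightarrow> nat \<Rightarrow> (nat \<times> nat) list option \<Rightarrow> nstate \<Rightarrow> nstate" where
  "update n v t r st = learn n v t r
     (if t < n \<or> chan n t \<le> lg n then st
      else let j = chan n t - 1 - lg n in gossip_update n v j (slot n t mod block n j) (r \<noteq> None) st)"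

definition start :: "nat \<Rightarrow> nstate" where
  "start v = \<lparr>known = [(v, v)], since = None, joined = (\<lambda>_. False), key = (\<lambda>_. 0),
     bits = (\<lambda>_. 0), informed = (\<lambda>_. False)\<rparr>"

text \<open>A protocol sees only the history, so the state is recomputed from it. The newest entry
  comes first, which makes \<open>length h\<close> the step being processed.\<close>

primrec state_rev :: "nat \<Rightarrow> nat \<Rightarrow> history \<Rightarrow> nstate" where
  "state_rev n v [] = start v"
| "state_rev n v (m # h) =
     update n v (length h) (map_option (\<lambda>m. from_nat (content m)) m) (state_rev n v h)"

definition state_of :: "nat \<Rightarrow> nat \<Rightarrow> history \<Rightarrow> nstate" where
  "state_of n v h = state_rev n v (rev h)"

definition gather :: protocol where
  "gather n v h =
     (if sends n v (length h) (state_of n v h)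
      then Some (Message (held_rumors v h) (to_nat (known (state_of n v h)))) else None)"

lemma valid_gather: "valid_protocol gather"
  by (auto simp: valid_protocol_def gather_def)

lemma length_run: "length (run P n E t v) = t"
  by (induction t) auto

section \<open>Runs of the protocol and the growth of knowledge\<close>

locale network =
  fixes n :: nat and E :: "(nat \<times> nat) set"
  assumes n_pos: "0 < n" and E_subset: "E \<subseteq> {..<n} \<times> {..<n}"
begin

definition st :: "nat \<Rightarrow> nat \<Rightarrow> nstate" where
  "st t v = state_of n v (run gather n E t v)"

definition tx :: "nat \<Rightarrow> nat \<Rightarrow> bool" where
  "tx t v \<longleftrightarrow> sends n v t (st t v)"

definition hears :: "nat \<Rightarrow> nat \<Rightarrow> nat \<Rightarrow> bool" where
  "hears t v u \<longleftrightarrow> \<not> tx t v \<and> (u, v) \<in> E \<and> tx t u \<and> (\<forall>u'. (u', v) \<in> E \<and> tx t u' \<longrightarrow> u' = u)"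

definition rcv :: "nat \<Rightarrow> nat \<Rightarrow> (nat \<times> nat) list option" where
  "rcv t v = (if \<exists>u. hears t v u then Some (known (st t (THE u. hears t v u))) else None)"

definition W :: "nat \<Rightarrow> nat \<Rightarrow> (nat \<times> nat) set" where
  "W t v = set (known (st t v))"

text \<open>This is the most that \<open>v\<close> can ever know: all marks of its ancestors and all
  edges into them.\<close>

definition full :: "nat \<Rightarrow> (nat \<times> nat) set" where
  "full v = {(u, x). (x, v) \<in> E\<^sup>* \<and> ((u, x) \<in> E \<or> u = x)}"

lemma hears_unique: "hears t v u \<Longrightarrow> hears t v u' \<Longrightarrow> u' = u"
  by (auto simp: hears_def)

lemma rcv_hears: "hears t v u \<Longrightarrow> rcv t v = Some (known (st t u))"
  unfolding rcv_def using hears_unique by (metis (no_types, lifting) the_equality)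

lemma gather_run:
  "gather n v (run gather n E t v) =
     (if tx t v then Some (Message (held_rumors v (run gather n E t v)) (to_nat (known (st t v)))) else None)"
  by (simp add: gather_def tx_def st_def length_run)

lemma reception_cases:
  shows reception_hears: "hears t v u \<Longrightarrow>
      reception E (\<lambda>u. gather n u (run gather n E t u)) v =
        Some (Message (held_rumors u (run gather n E t u)) (to_nat (known (st t u))))" (is "_ \<Longrightarrow> ?R")
    and reception_None: "\<forall>u. \<not> hears t v u \<Longrightarrow>
      reception E (\<lambda>u. gather n u (run gather n E t u)) v = None" (is "_ \<Longrightarrow> ?N")
proof -
  have T: "transmitting_in_neighbors E (\<lambda>u. gather n u (run gather n E t u)) v = {u. (u, v) \<in> E \<and> tx t u}"
    by (auto simp: transmitting_in_neighbors_def gather_run)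
  have idle: "gather n v (run gather n E t v) = None \<longleftrightarrow> \<not> tx t v"
    by (simp add: gather_run)
  show ?R if u: "hears t v u"
  proof -
    have u': "\<not> tx t v" "\<And>w. (w, v) \<in> E \<and> tx t w \<longleftrightarrow> w = u" "tx t u"
      using u unfolding hears_def by blast+
    show ?thesis using u'(1,3) by (simp add: reception_def T idle u'(2) gather_run[of u])
  qed
  show ?N if "\<forall>u. \<not> hears t v u"
  proof -
    have "\<not> (\<not> tx t v \<and> (\<exists>!u. (u, v) \<in> E \<and> tx t u))" using that unfolding hears_def by blast
    then show ?thesis by (auto simp: reception_def T idle)
  qed
qed

lemma st_0: "st 0 v = start v"
  by (simp add: st_def state_of_def)

lemma st_Suc: "st (Suc t) v = update n v t (rcv t v) (st t v)"
proof -
  have "map_option (\<lambda>m. from_nat (content m)) (reception E (\<lambda>u. gather n u (run gather n E t u)) v) = rcv t v"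
  proof (cases "\<exists>u. hears t v u")
    case True
    then obtain u where u: "hears t v u" by blast
    show ?thesis by (simp add: reception_hears[OF u] rcv_hears[OF u])
  qed (simp add: reception_None rcv_def)
  then show ?thesis by (simp add: st_def state_of_def length_run)
qed

lemma known_update: "known (update n v t r s) =
    (case r of None \<Rightarrow> known s | Some l \<Rightarrow> if t < n then (t, v) # known s else known s @ l)"
  by (simp add: update_def learn_def gossip_update_def Let_def split: option.split)

lemma since_update: "since (update n v t r s) =
    (if since s \<noteq> None then since s
     else if n \<le> Suc t \<and> closed_knowledge (set (known (update n v t r s))) then Some (Suc t) else None)"
  by (simp add: update_def learn_def gossip_update_def Let_def split: option.split)

lemma W_init_Suc: "t < n \<Longrightarrow> W (Suc t) v = (if \<exists>u. hears t v u then insert (t, v) (W t v) else W t v)"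
  by (auto simp: W_def st_Suc known_update rcv_def)

lemma W_Suc: "n \<le> t \<Longrightarrow> W (Suc t) v = W t v \<union> (\<Union>u\<in>{u. hears t v u}. W t u)"
proof (cases "\<exists>u. hears t v u")
  case True
  then obtain u where u: "hears t v u" by blast
  then have "{u. hears t v u} = {u}" using hears_unique by blast
  moreover assume "n \<le> t"
  ultimately show ?thesis by (simp add: W_def st_Suc known_update rcv_hears[OF u])
qed (simp add: W_def st_Suc known_update rcv_def)

lemma W_hears: "n \<le> t \<Longrightarrow> hears t v u \<Longrightarrow> W t u \<subseteq> W (Suc t) v"
  by (auto simp: W_Suc)

lemma W_mono: "t \<le> t' \<Longrightarrow> W t v \<subseteq> W t' v"
proof (induction t' rule: dec_induct)
  case (step k)
  then show ?case by (cases "k < n") (auto simp: W_init_Suc W_Suc)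
qed simp

lemma self_in_W: "(v, v) \<in> W t v"
  using W_mono[of 0 t v] by (auto simp: W_def st_0 start_def)

lemma W_initial: "t \<le> n \<Longrightarrow> W t v = insert (v, v) {(u, v) | u. u < t \<and> (u, v) \<in> E}"
proof (induction t)
  case 0
  then show ?case by (simp add: W_def st_0 start_def)
next
  case (Suc t)
  then have tx: "tx t u \<longleftrightarrow> u = t" for u by (auto simp: tx_def sends_def)
  have "(\<exists>u. hears t v u) \<longleftrightarrow> v \<noteq> t \<and> (t, v) \<in> E" by (auto simp: hears_def tx)
  then show ?case using Suc by (auto simp: W_init_Suc less_Suc_eq)
qed

lemma full_mono: "(u, v) \<in> E\<^sup>* \<Longrightarrow> full u \<subseteq> full v"
  by (auto simp: full_def)

lemma W_subset_full: "W t v \<subseteq> full v"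
proof (induction t arbitrary: v)
  case 0
  then show ?case by (auto simp: W_def st_0 start_def full_def)
next
  case (Suc t)
  show ?case
  proof (cases "t < n")
    case True
    then have "Suc t \<le> n" by simp
    then show ?thesis by (auto simp: W_initial full_def)
  next
    case False
    have "W t u \<subseteq> full v" if "hears t v u" for u
      using Suc[of u] full_mono[of u v] that by (auto simp: hears_def)
    then show ?thesis using False Suc[of v] by (auto simp: W_Suc)
  qed
qed

text \<open>After the initial round robin each node knows exactly its own column, and later
  knowledge is merged only as whole sets, so a mark never travels without its edges.\<close>

lemma column_in_W:
  assumes "n \<le> t" "(x, x) \<in> W t v" "(u, x) \<in> E"
  shows "(u, x) \<in> W t v"
  using assms
proof (induction t arbitrary: v rule: dec_induct)
  case base
  then show ?case using E_subset by (auto simp: W_initial)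
next
  case (step t)
  then show ?case by (auto simp: W_Suc)
qed

text \<open>Backwards along a path to \<open>v\<close>: a known mark of \<open>z\<close> brings the
  edge \<open>(y, z)\<close>, and closedness then gives the mark of \<open>y\<close>. Thus
  completeness can be detected locally.\<close>

lemma closed_W_full:
  assumes "n \<le> t" "closed_knowledge (W t v)"
  shows "W t v = full v"
proof -
  have "(x, x) \<in> W t v" if "(x, v) \<in> E\<^sup>*" for x
    using that
  proof (induction rule: converse_rtrancl_induct)
    case base
    then show ?case by (rule self_in_W)
  next
    case (step y z)
    then have "(y, z) \<in> W t v" using column_in_W[OF assms(1)] by blast
    then show ?case using assms(2) by (auto simp: closed_knowledge_def)
  qed
  then have "full v \<subseteq> W t v" using column_in_W[OF assms(1)] by (auto simp: full_def)
  then show ?thesis using W_subset_full by blast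
qed

lemma closed_full: "closed_knowledge (full v)"
  by (auto simp: closed_knowledge_def full_def intro: converse_rtrancl_into_rtrancl)

lemma closed_W_iff: "n \<le> t \<Longrightarrow> closed_knowledge (W t v) \<longleftrightarrow> full v \<subseteq> W t v"
  using closed_W_full closed_full W_subset_full by (metis subset_antisym subset_refl)

lemma since_Suc: "since (st (Suc t) v) =
    (if since (st t v) \<noteq> None then since (st t v)
     else if n \<le> Suc t \<and> full v \<subseteq> W (Suc t) v then Some (Suc t) else None)"
  unfolding st_Suc since_update unfolding st_Suc[symmetric] W_def[symmetric]
  using closed_W_iff[of "Suc t" v] by auto

lemma since_SomeD: "since (st t v) = Some t0 \<Longrightarrow> n \<le> t0 \<and> t0 \<le> t \<and> full v \<subseteq> W t0 v"
  by (induction t) (auto simp: st_0 start_def since_Suc split: if_splits)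

lemma since_None_iff: "since (st t v) = None \<longleftrightarrow> \<not> (n \<le> t \<and> full v \<subseteq> W t v)"
proof
  assume "since (st t v) = None"
  then show "\<not> (n \<le> t \<and> full v \<subseteq> W t v)"
    using n_pos by (cases t) (auto simp: since_Suc split: if_splits)
next
  assume neg: "\<not> (n \<le> t \<and> full v \<subseteq> W t v)"
  show "since (st t v) = None"
  proof (cases "since (st t v)")
    case (Some t0)
    then have "n \<le> t \<and> full v \<subseteq> W t v" using since_SomeD[OF Some] W_mono[of t0 t v] by auto
    then show ?thesis using neg by blast
  qed
qed

lemma since_mono: "since (st t v) = Some t0 \<Longrightarrow> t \<le> t' \<Longrightarrow> since (st t' v) = Some t0"
  by (rotate_tac, induction t' rule: dec_induct) (auto simp: since_Suc)

lemma since_unique: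
  assumes "since (st t v) = Some t0" "since (st t' v) = Some t1"
  shows "t0 = t1"
  using since_mono[OF assms(1), of "max t t'"] since_mono[OF assms(2), of "max t t'"] by simp

lemma since_at: "since (st t v) = Some t0 \<Longrightarrow> t0 \<le> t' \<Longrightarrow> since (st t' v) = Some t0"
proof -
  assume t0: "since (st t v) = Some t0" and le: "t0 \<le> t'"
  have "since (st t0 v) \<noteq> None" using since_SomeD[OF t0] since_None_iff by auto
  then obtain t1 where t1: "since (st t0 v) = Some t1" by blast
  then have "t1 = t0" using since_unique t0 by blast
  then show ?thesis using since_mono[OF t1 le] by simp
qed

lemma held_rumors_run_Suc:
  "held_rumors v (run gather n E (Suc t) v) = held_rumors v (run gather n E t v) \<union>
     (\<Union>u\<in>{u. hears t v u}. held_rumors u (run gather n E t u))"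
proof -
  have held: "held_rumors v (h @ [r]) =
      held_rumors v h \<union> (case r of None \<Rightarrow> {} | Some m \<Rightarrow> rumors m)" for h r
    by (auto simp: held_rumors_def split: option.split)
  show ?thesis
  proof (cases "\<exists>u. hears t v u")
    case True
    then obtain u where u: "hears t v u" by blast
    then have "{u. hears t v u} = {u}" using hears_unique by blast
    then show ?thesis by (simp add: held reception_hears[OF u])
  qed (simp add: held reception_None)
qed

text \<open>Each message carries all rumors that its sender holds along with its whole list, so
  marks and rumors travel together; the initial round robin adds no mark but the node's own.\<close>

lemma W_held: "(x, x) \<in> W t v \<Longrightarrow> x \<in> held_rumors v (run gather n E t v)"
proof (induction t arbitrary: v)
  case 0
  then show ?case by (auto simp: W_initial held_rumors_def)
next
  case (Suc t)
  show ?case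
  proof (cases "t < n")
    case True
    then have tx: "tx t u \<longleftrightarrow> u = t" for u by (auto simp: tx_def sends_def)
    have "(x, x) \<in> W t v \<or> (\<exists>u. hears t v u) \<and> x = v"
      using Suc.prems True by (auto simp: W_init_Suc split: if_splits)
    then show ?thesis using Suc.IH[of v] by (auto simp: held_rumors_run_Suc simp del: run.simps)
        (simp add: held_rumors_def)
  next
    case False
    then have "(x, x) \<in> W t v \<or> (\<exists>u. hears t v u \<and> (x, x) \<in> W t u)"
      using Suc.prems by (auto simp: W_Suc)
    then show ?thesis using Suc.IH unfolding held_rumors_run_Suc by blast
  qed
qed

lemma gathering_completed_if_since:
  assumes "since (st t v) \<noteq> None" "\<forall>u<n. (u, v) \<in> E\<^sup>*"
  shows "gathering_completed gather n E v t"
proof -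
  have "full v \<subseteq> W t v" using assms(1) since_None_iff[of t v] by simp
  then have "(u, u) \<in> W t v" if "u < n" for u using assms(2) that by (auto simp: full_def)
  then show ?thesis using W_held by (auto simp: gathering_completed_def)
qed

end

lemma channels_pos: "0 < channels n" by (simp add: channels_def)

lemma strong_len_pos: "0 < strong_len n a" by (simp add: strong_len_def lg_pos)

lemma strong_len_mono: "a \<le> b \<Longrightarrow> strong_len n a \<le> strong_len n b"
  by (simp add: strong_len_def power_increasing)

section \<open>Delivery by complete nodes\<close>

context network
begin

definition completes :: "nat \<Rightarrow> nat \<Rightarrow> bool" where
  "completes v t \<longleftrightarrow> since (st t v) = Some t"

lemma since_completes: "since (st t v) = Some t0 \<Longrightarrow> completes v t0"
  unfolding completes_def using since_at by blast

lemma completes_since: "completes v t0 \<Longrightarrow> t0 \<le> t \<Longrightarrow> since (st t v) = Some t0"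
  unfolding completes_def using since_at by blast

lemma completes_unique: "completes v t \<Longrightarrow> completes v t' \<Longrightarrow> t = t'"
  unfolding completes_def using since_unique by blast

lemma completes_full: "completes v t0 \<Longrightarrow> t0 \<le> t \<Longrightarrow> n \<le> t0 \<and> full v \<subseteq> W t v"
  unfolding completes_def using since_SomeD W_mono by blast

lemma incomplete_before: "since (st t v) = None \<Longrightarrow> t' \<le> t \<Longrightarrow> since (st t' v) = None"
  using since_mono by (metis not_None_eq)

text \<open>Channel 0 is free of collisions, as each of its slots belongs to one label. The
  incomplete \<open>y\<close> is silent there and hears \<open>x\<close> within one cycle.\<close>

lemma round_robin_delivers:
  assumes x: "completes x t0" and xy: "(x, y) \<in> E" and t: "t0 + channels n * n \<le> t"
    and y: "since (st t y) = None"
  shows "full x \<subseteq> W t y"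
proof -
  have "x < n" using xy E_subset by auto
  from window_hits_slot[OF channels_pos[of n] this, of "t0 - n"] obtain \<tau> where
    \<tau>: "t0 - n \<le> \<tau>" "\<tau> < t0 - n + channels n * n" "\<tau> mod channels n = 0" "\<tau> div channels n mod n = x"
    by (elim exE conjE)
  define T where "T = \<tau> + n"
  have n0: "n \<le> t0" using completes_full[OF x order_refl] by simp
  have T: "t0 \<le> T" "Suc T \<le> t" "n \<le> T" using \<tau> n0 t by (auto simp: T_def)
  have ch: "chan n T = 0" "slot n T mod n = x" using \<tau> by (simp_all add: chan_def slot_def T_def)
  have tx: "tx T u \<longleftrightarrow> since (st T u) \<noteq> None \<and> u = x" for u
    using ch T by (auto simp: tx_def sends_def)
  have "since (st T y) = None" using incomplete_before[OF y] T by simp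
  moreover have "since (st T x) = Some t0" using completes_since[OF x] T by simp
  ultimately have "hears T y x" using xy by (auto simp: hears_def tx)
  then have "W T x \<subseteq> W (Suc T) y" using W_hears T by blast
  then show ?thesis using completes_full[OF x T(1)] W_mono[OF T(2), of y] by blast
qed

text \<open>Only nodes whose active period overlaps that of \<open>x\<close> can interfere. If fewer
  than \<open>2 ^ a\<close> nodes complete that close to \<open>t0\<close>, the family isolates
  \<open>x\<close> among them.\<close>

lemma selector_delivers:
  assumes x: "completes x t0" and xy: "(x, y) \<in> E" and t: "t0 + channels n * strong_len n a \<le> t"
    and y: "since (st t y) = None" and a: "a < lg n" and undelivered: "\<not> full x \<subseteq> W t y"
  shows "2 ^ a \<le> card {z. z < n \<and> (\<exists>t1. completes z t1 \<and>
    t1 < t0 + channels n * strong_len n a \<and> t0 < t1 + channels n * strong_len n a)}" (is "_ \<le> card ?N")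
proof (rule ccontr)
  assume neg: "\<not> ?thesis"
  define m where "m = strong_len n a"
  \<comment> \<open>Selectivity needs one fixed set, so \<open>Y\<close> collects the in-neighbors
    active at any moment of the period of \<open>x\<close>.\<close>
  define Y where "Y = {z. z \<noteq> x \<and> (z, y) \<in> E \<and> (\<exists>T t1. t0 \<le> T \<and> T < t0 + channels n * m \<and>
    since (st T z) = Some t1 \<and> T < t1 + channels n * m)}"
  have "Y \<subseteq> ?N"
  proof
    fix z assume "z \<in> Y"
    then obtain T t1 where z: "(z, y) \<in> E" "t0 \<le> T" "T < t0 + channels n * m"
      "since (st T z) = Some t1" "T < t1 + channels n * m" by (auto simp: Y_def)
    then have "z < n" "completes z t1" "t1 \<le> T"
      using E_subset since_completes since_SomeD by blast+
    then show "z \<in> ?N" using z unfolding m_def by (intro CollectI conjI exI[of _ t1]) auto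
  qed
  moreover have "finite ?N" by simp
  ultimately have "card Y < 2 ^ a" using neg card_mono[of ?N Y] by simp
  moreover have "x < n" "Y \<subseteq> {..<n}" using xy E_subset by (auto simp: Y_def)
  ultimately obtain e where e: "e < m" "strong_fam n a e \<inter> ({x} \<union> Y) = {x}"
    using strong_fam[of n a, unfolded selective_def, rule_format, of "{x}" Y]
    by (auto simp: Y_def m_def)
  have "a + 1 < channels n" using a by (simp add: channels_def)
  from window_hits_slot[OF this e(1), of "t0 - n"] obtain \<tau> where
    \<tau>: "t0 - n \<le> \<tau>" "\<tau> < t0 - n + channels n * m" "\<tau> mod channels n = a + 1" "\<tau> div channels n mod m = e"
    by (elim exE conjE)
  define T where "T = \<tau> + n"
  have n0: "n \<le> t0" using completes_full[OF x order_refl] by simp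
  have T: "t0 \<le> T" "T < t0 + channels n * m" "Suc T \<le> t" "n \<le> T"
    using \<tau> n0 t by (auto simp: T_def m_def)
  have ch: "chan n T = a + 1" "slot n T mod m = e" using \<tau> by (simp_all add: chan_def slot_def T_def)
  have tx: "tx T u \<longleftrightarrow> (\<exists>t1. since (st T u) = Some t1 \<and> T < t1 + channels n * m) \<and> u \<in> strong_fam n a e" for u
    using ch T a by (auto simp: tx_def sends_def m_def)
  have "since (st T y) = None" using incomplete_before[OF y] T by simp
  then have "\<not> tx T y" by (simp add: tx)
  moreover have "since (st T x) = Some t0" using completes_since[OF x] T by simp
  then have "tx T x" using e T by (auto simp: tx)
  moreover have "u = x" if "(u, y) \<in> E" "tx T u" for u
  proof (rule ccontr)
    assume "u \<noteq> x"
    then have "u \<in> Y" using that T unfolding Y_def tx by blast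
    then show False using e that \<open>u \<noteq> x\<close> unfolding tx by blast
  qed
  ultimately have "hears T y x" using xy unfolding hears_def by blast
  then have "W T x \<subseteq> W (Suc T) y" using W_hears T by blast
  then show False using completes_full[OF x T(1)] W_mono[OF T(3), of y] undelivered by blast
qed

text \<open>The radius is two family durations: at most one separates \<open>t\<close> from the
  completion of the failing sender, and at most one separates that completion from those blamed for
  the failure.\<close>

definition crowd :: "nat \<Rightarrow> nat \<Rightarrow> nat set" where
  "crowd i t = {z. z < n \<and> (\<exists>t1. completes z t1 \<and>
     t1 \<le> t + 2 * channels n * strong_len n i \<and> t \<le> t1 + 2 * channels n * strong_len n i)}"

text \<open>Take the least \<open>i\<close> whose family, started at \<open>t0\<close>, is not yet
  over. For \<open>i = 0\<close> the node \<open>x\<close> itself is the crowd; otherwise family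
  \<open>i - 1\<close> has failed, which needs many completions nearby. The round robin would have
  delivered by now unless that family is at most \<open>n\<close> long.\<close>

lemma undelivered_crowd:
  assumes x: "completes x t0" "t0 \<le> t" and xy: "(x, y) \<in> E"
    and y: "since (st t y) = None" and undelivered: "\<not> full x \<subseteq> W t y"
  shows "\<exists>i\<le>lg n. (i = 0 \<or> strong_len n (i - 1) \<le> n) \<and> 2 ^ i \<le> 2 * card (crowd i t)"
proof -
  define C where "C = channels n"
  have tn: "t < t0 + C * n" using round_robin_delivers[OF x(1) xy _ y] undelivered by (auto simp: C_def not_le)
  define P where "P i \<longleftrightarrow> t < t0 + C * strong_len n i" for i
  have "n \<le> 2 ^ lg n" using less_two_power_lg less_imp_le by blast
  also have "(2::nat) ^ lg n \<le> 4 ^ lg n" by (simp add: power_mono)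
  also have "\<dots> \<le> strong_len n (lg n)" using lg_pos[of n] by (simp add: strong_len_def)
  finally have "C * n \<le> C * strong_len n (lg n)" by simp
  then have PL: "P (lg n)" using tn unfolding P_def by linarith
  define i where "i = (LEAST i. P i)"
  have i: "P i" "i \<le> lg n" "\<And>k. k < i \<Longrightarrow> \<not> P k"
    using PL unfolding i_def by (auto intro: LeastI Least_le dest: not_less_Least)
  have fin: "finite (crowd i t)" by (simp add: crowd_def)
  show ?thesis
  proof (cases i)
    case 0
    have "x < n" using xy E_subset by auto
    moreover have "t \<le> t0 + 2 * channels n * strong_len n 0" using i 0 by (simp add: P_def C_def)
    ultimately have "x \<in> crowd 0 t" using x unfolding crowd_def by (intro CollectI conjI exI[of _ t0]) auto
    then have "card (crowd 0 t) \<noteq> 0" using fin 0 by auto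
    then show ?thesis using 0 by (intro exI[of _ 0]) simp
  next
    case (Suc a)
    then have a: "t0 + C * strong_len n a \<le> t" "a < lg n" using i(3)[of a] i(2) by (auto simp: P_def)
    have sub: "{z. z < n \<and> (\<exists>t1. completes z t1 \<and>
      t1 < t0 + C * strong_len n a \<and> t0 < t1 + C * strong_len n a)} \<subseteq> crowd i t" (is "?N \<subseteq> _")
    proof
      fix z assume "z \<in> ?N"
      then obtain t1 where z: "z < n" "completes z t1" "t1 < t0 + C * strong_len n a" "t0 < t1 + C * strong_len n a"
        by auto
      have "C * strong_len n a \<le> C * strong_len n i" using Suc by (intro mult_le_mono2 strong_len_mono) simp
      then have "t \<le> t1 + 2 * (C * strong_len n i)" using z i(1) unfolding P_def by linarith
      then show "z \<in> crowd i t" using z a unfolding crowd_def C_def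
        by (intro CollectI conjI exI[of _ t1]) (auto simp: mult.assoc)
    qed
    have "2 ^ a \<le> card ?N"
      unfolding C_def by (rule selector_delivers[OF x(1) xy _ y a(2) undelivered]) (use a in \<open>simp add: C_def\<close>)
    also have "\<dots> \<le> card (crowd i t)" by (rule card_mono[OF fin sub])
    finally have "2 ^ i \<le> 2 * card (crowd i t)" using Suc by simp
    moreover have "C * strong_len n a < C * n" using a tn by linarith
    then have "strong_len n (i - 1) \<le> n" using Suc by simp
    ultimately show ?thesis using i(2) by blast
  qed
qed

end

lemma bct_pos: "0 < bct n j"
  using lg_pos[of n] by (simp add: bct_def bcast_time_def)

lemma key_bits_pos: "0 < key_bits n"
  by (simp add: key_bits_def)

section \<open>Gossiping in a strongly connected component\<close>

text \<open>The complete outside in-neighbors do not join the block and hence cannot disturb it.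
  \<open>T\<close> is jointly held at \<open>tb\<close> and bounds the knowledge in \<open>A\<close>
  at all times, so only redistribution inside \<open>A\<close> is left.\<close>

locale gossip_block = network +
  fixes A :: "nat set" and j :: nat and tb :: nat and T :: "(nat \<times> nat) set"
  assumes A_subset: "A \<subseteq> {..<n}" and A_ne: "A \<noteq> {}" and A_card: "card A \<le> 2 ^ j"
    and A_sc: "strongly_connected_on E A"
    and tb: "n \<le> tb" "chan n tb = 1 + lg n + j" "slot n tb mod block n j = 0"
    and A_incomplete: "\<And>v. v \<in> A \<Longrightarrow> since (st tb v) = None"
    and outside_complete: "\<And>u v. (u, v) \<in> E \<Longrightarrow> v \<in> A \<Longrightarrow> u \<notin> A \<Longrightarrow> since (st tb u) \<noteq> None"
    and W_T: "\<And>t v. v \<in> A \<Longrightarrow> W t v \<subseteq> T" and T_W: "T \<subseteq> (\<Union>v\<in>A. W tb v)"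
    and T_subset: "T \<subseteq> {..<n} \<times> {..<n}"
begin

definition time :: "nat \<Rightarrow> nat" where "time k = tb + channels n * k"

definition V :: "nat \<Rightarrow> nat \<Rightarrow> (nat \<times> nat) set" where "V k v = W (time k) v"

text \<open>These are the values in force at offset \<open>k\<close>, after the resets made when an
  election or a broadcast opens, as opposed to the stored fields.\<close>

definition Key :: "nat \<Rightarrow> nat \<Rightarrow> nat" where "Key k v = key_at n v j k (st (time k) v)"
definition Bits :: "nat \<Rightarrow> nat \<Rightarrow> nat" where "Bits k v = bits_at n j k (st (time k) v)"
definition Informed :: "nat \<Rightarrow> nat \<Rightarrow> bool" where "Informed k v = informed_at n v j k (st (time k) v)"
definition Joined :: "nat \<Rightarrow> nat \<Rightarrow> bool" where "Joined k v = joined_at j k (st (time k) v)"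
definition Rcv :: "nat \<Rightarrow> nat \<Rightarrow> bool" where "Rcv k v \<longleftrightarrow> (\<exists>u. hears (time k) v u)"
definition Sends :: "nat \<Rightarrow> nat \<Rightarrow> bool" where
  "Sends k v \<longleftrightarrow> (if k < rounds n j * n then k mod n = v else Informed k v \<and> v \<in> bcast_set n (bstep n j k))"

lemma finite_A: "finite A" by (rule finite_subset[OF A_subset]) simp

lemma finite_T: "finite T" by (rule finite_subset[OF T_subset]) simp

lemma time_ge: "n \<le> time k" using tb by (simp add: time_def)

lemma time_Suc: "time (Suc k) = time k + channels n" by (simp add: time_def)

lemma time_mono: "k \<le> k' \<Longrightarrow> time k \<le> time k'" by (simp add: time_def)

lemma time_minus: "time k - n = (tb - n) + channels n * k" using tb by (simp add: time_def)

lemma chan_time: "chan n (time k) = 1 + lg n + j"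
  using tb(2) by (simp add: chan_def time_minus)

lemma slot_time: "k < block n j \<Longrightarrow> slot n (time k) mod block n j = k"
proof -
  assume k: "k < block n j"
  have "slot n (time k) = slot n tb + k"
    using channels_pos[of n] by (simp add: slot_def time_minus)
  then have "slot n (time k) mod block n j = (slot n tb mod block n j + k) mod block n j"
    by (simp add: mod_simps)
  then show ?thesis using tb(3) k by simp
qed

lemma chan_between:
  assumes "time k < t" "t < time (Suc k)"
  shows "n \<le> t" "chan n t \<noteq> 1 + lg n + j"
proof -
  show "n \<le> t" using assms time_ge[of k] by simp
  obtain i where i: "t = time k + i" "0 < i" "i < channels n"
    using assms less_imp_add_positive[of "time k" t] by (auto simp: time_Suc)
  have "t - n = (tb - n + i) + channels n * k" using i time_minus[of k] time_ge[of k] by simp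
  then have "chan n t = (chan n tb + i) mod channels n" by (simp add: chan_def mod_simps)
  moreover have "chan n tb < channels n" using channels_pos by (simp add: chan_def)
  ultimately have "chan n t \<noteq> chan n tb"
    using i by (cases "chan n tb + i < channels n") (auto simp: mod_if[of _ "channels n"])
  then show "chan n t \<noteq> 1 + lg n + j" using tb by simp
qed

lemma V_mono: "k \<le> k' \<Longrightarrow> V k v \<subseteq> V k' v"
  unfolding V_def by (intro W_mono time_mono)

lemma V_hears: "hears (time k) v u \<Longrightarrow> V k u \<subseteq> V (Suc k) v"
  using W_hears[OF time_ge] W_mono[of "Suc (time k)" "time (Suc k)" v] channels_pos[of n]
  by (fastforce simp: V_def time_Suc)

lemma gossip_fields_stable:
  assumes "n \<le> t" "chan n t \<noteq> 1 + lg n + j"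
  shows "joined (st (Suc t) v) j = joined (st t v) j" "key (st (Suc t) v) j = key (st t v) j"
    "bits (st (Suc t) v) j = bits (st t v) j" "informed (st (Suc t) v) j = informed (st t v) j"
  using assms by (auto simp: st_Suc update_def learn_def gossip_update_def Let_def)

lemma gossip_fields_between:
  assumes "i < channels n"
  shows "joined (st (time k + Suc i) v) j = joined (st (Suc (time k)) v) j \<and>
    key (st (time k + Suc i) v) j = key (st (Suc (time k)) v) j \<and>
    bits (st (time k + Suc i) v) j = bits (st (Suc (time k)) v) j \<and>
    informed (st (time k + Suc i) v) j = informed (st (Suc (time k)) v) j"
  using assms
proof (induction i)
  case (Suc i)
  have "n \<le> time k + Suc i" "chan n (time k + Suc i) \<noteq> 1 + lg n + j"
    using chan_between[of k "time k + Suc i"] Suc.prems by (auto simp: time_Suc)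
  from gossip_fields_stable[OF this, of v] Suc show ?case by simp
qed simp

lemma gossip_fields_Suc:
  assumes "k < block n j"
  shows "joined (st (time (Suc k)) v) j = Joined k v"
    "key (st (time (Suc k)) v) j = Key k v"
    "bits (st (time (Suc k)) v) j =
      (if bstep n j k = bct n j - 1 then 2 * Bits k v + of_bool (Informed k v \<or> Rcv k v) else Bits k v)"
    "informed (st (time (Suc k)) v) j = (Informed k v \<or> Rcv k v)"
proof -
  obtain c where c: "channels n = Suc c" using channels_pos[of n] gr0_conv_Suc by blast
  then have t: "time (Suc k) = time k + Suc c" by (simp add: time_Suc)
  note b = gossip_fields_between[of c k v, folded t]
  have up: "st (Suc (time k)) v = learn n v (time k) (rcv (time k) v)
      (gossip_update n v j k (Rcv k v) (st (time k) v))"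
    using time_ge[of k] chan_time[of k] slot_time[OF assms]
    by (simp add: st_Suc update_def Let_def Rcv_def rcv_def)
  show "joined (st (time (Suc k)) v) j = Joined k v" "key (st (time (Suc k)) v) j = Key k v"
    "bits (st (time (Suc k)) v) j =
      (if bstep n j k = bct n j - 1 then 2 * Bits k v + of_bool (Informed k v \<or> Rcv k v) else Bits k v)"
    "informed (st (time (Suc k)) v) j = (Informed k v \<or> Rcv k v)"
    using b c by (simp_all add: up learn_def Let_def gossip_update_def Joined_def Key_def Bits_def Informed_def)
qed

lemma Joined_const: "k < block n j \<Longrightarrow> Joined k v = (since (st tb v) = None)"
proof (induction k)
  case 0
  then show ?case by (simp add: Joined_def joined_at_def time_def)
next
  case (Suc k)
  then show ?case using gossip_fields_Suc(1)[of k v] by (simp add: Joined_def joined_at_def)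
qed

lemma tx_time:
  assumes "k < block n j"
  shows "tx (time k) v \<longleftrightarrow> since (st tb v) = None \<and> Sends k v"
  using time_ge[of k] chan_time[of k] slot_time[OF assms] Joined_const[OF assms, of v]
  by (simp add: tx_def sends_def Let_def gossip_sends_def Sends_def Joined_def Informed_def)

lemma hears_time:
  assumes "k < block n j" "v \<in> A"
  shows "hears (time k) v u \<longleftrightarrow> \<not> Sends k v \<and> u \<in> A \<and> (u, v) \<in> E \<and> Sends k u \<and>
    (\<forall>u'\<in>A. (u', v) \<in> E \<and> Sends k u' \<longrightarrow> u' = u)"
proof -
  have "(u', v) \<in> E \<and> tx (time k) u' \<longleftrightarrow> u' \<in> A \<and> (u', v) \<in> E \<and> Sends k u'" for u'
    using tx_time[OF assms(1), of u'] A_incomplete outside_complete[OF _ assms(2), of u'] by blast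
  moreover have "tx (time k) v \<longleftrightarrow> Sends k v"
    using tx_time[OF assms(1)] A_incomplete[OF assms(2)] by blast
  ultimately show ?thesis unfolding hears_def by blast
qed

definition holders :: "nat \<Rightarrow> nat \<times> nat \<Rightarrow> nat set" where
  "holders k x = {v\<in>A. x \<in> V k v}"

text \<open>Each round robin slot belongs to one label, so the turn of \<open>u\<close> reaches all
  its out-neighbors in \<open>A\<close> without collision.\<close>

lemma round_spreads:
  assumes "q < rounds n j" "u \<in> A" "v \<in> A" "(u, v) \<in> E"
  shows "V (q * n) u \<subseteq> V (Suc q * n) v"
proof -
  define k where "k = q * n + u"
  have un: "u < n" using assms A_subset by auto
  have "k < Suc q * n" using un by (simp add: k_def)
  also have "Suc q * n \<le> rounds n j * n" using assms(1) by (intro mult_le_mono1) simp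
  finally have k: "k < rounds n j * n" .
  then have kb: "k < block n j" by (simp add: block_def)
  have S: "Sends k w \<longleftrightarrow> w = u" for w using k un by (auto simp: Sends_def k_def)
  have "V k u \<subseteq> V (Suc k) v"
  proof (cases "v = u")
    case True
    then show ?thesis using V_mono by simp
  next
    case False
    then have "hears (time k) v u" using assms by (simp add: hears_time[OF kb] S)
    then show ?thesis by (rule V_hears)
  qed
  moreover have "V (q * n) u \<subseteq> V k u" "V (Suc k) v \<subseteq> V (Suc q * n) v"
    using \<open>k < Suc q * n\<close> by (auto intro!: V_mono simp del: mult_Suc simp: k_def)
  ultimately show ?thesis by blast
qed

lemma holders_mono: "k \<le> k' \<Longrightarrow> holders k x \<subseteq> holders k' x"
  using V_mono by (auto simp: holders_def)

lemma holders_subset: "holders k x \<subseteq> A" by (auto simp: holders_def)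

lemma finite_holders: "finite (holders k x)"
  using finite_subset[OF holders_subset finite_A] .

text \<open>As long as the holders of \<open>x\<close> are not all of \<open>A\<close>, strong
  connectivity gives an edge leaving them, so every round adds a holder.\<close>

lemma card_holders_rounds:
  assumes "x \<in> T" "q \<le> rounds n j"
  shows "min (q + 1) (card A) \<le> card (holders (q * n) x)"
  using assms(2)
proof (induction q)
  case 0
  have "holders 0 x \<noteq> {}" using assms(1) T_W by (auto simp: holders_def V_def time_def)
  then have "card (holders 0 x) \<noteq> 0" using finite_holders by simp
  then show ?case by simp
next
  case (Suc q)
  let ?R = "holders (q * n) x" and ?R' = "holders (Suc q * n) x"
  have sub: "?R \<subseteq> ?R'" by (rule holders_mono) simp
  show ?case
  proof (cases "?R = A")
    case True
    then have "?R' = A" using sub holders_subset by blast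
    then show ?thesis by simp
  next
    case False
    have "card A \<noteq> 0" using A_ne finite_A by simp
    then have "?R \<noteq> {}" using Suc by auto
    from strongly_connected_on_leaving_edge[OF A_sc holders_subset this False]
    obtain u w where uw: "u \<in> ?R" "w \<in> A - ?R" "(u, w) \<in> E" by blast
    then have "V (q * n) u \<subseteq> V (Suc q * n) w"
      using Suc.prems subsetD[OF holders_subset uw(1)] by (intro round_spreads) auto
    then have "w \<in> ?R'" using uw by (auto simp: holders_def)
    then have "?R \<subset> ?R'" using sub uw by blast
    then have "card ?R < card ?R'" by (rule psubset_card_mono[OF finite_holders])
    then show ?thesis using Suc by simp
  qed
qed

section \<open>Elections by binary search\<close>

definition mstart :: "nat \<Rightarrow> nat" where
  "mstart \<mu> = rounds n j * n + \<mu> * (key_bits n * bct n j)"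

definition pstart :: "nat \<Rightarrow> nat \<Rightarrow> nat" where
  "pstart \<mu> \<phi> = mstart \<mu> + \<phi> * bct n j"

lemma mstart_Suc: "mstart (Suc \<mu>) = pstart \<mu> (key_bits n)"
  by (simp add: mstart_def pstart_def)

lemma pstart_Suc: "pstart \<mu> (Suc \<phi>) = pstart \<mu> \<phi> + bct n j"
  by (simp add: pstart_def)

lemma pstart_0: "pstart \<mu> 0 = mstart \<mu>"
  by (simp add: pstart_def)

lemma bstep_bphase:
  assumes "\<phi> < key_bits n" "\<delta> < bct n j"
  shows "bstep n j (pstart \<mu> \<phi> + \<delta>) = \<delta>" "bphase n j (pstart \<mu> \<phi> + \<delta>) = \<phi>"
proof -
  have eq: "pstart \<mu> \<phi> + \<delta> - rounds n j * n = \<delta> + (\<mu> * key_bits n + \<phi>) * bct n j"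
    by (simp add: pstart_def mstart_def algebra_simps)
  show "bstep n j (pstart \<mu> \<phi> + \<delta>) = \<delta>" unfolding bstep_def eq using assms by simp
  have "(\<delta> + (\<mu> * key_bits n + \<phi>) * bct n j) div bct n j = \<mu> * key_bits n + \<phi>"
    using assms by simp
  then show "bphase n j (pstart \<mu> \<phi> + \<delta>) = \<phi>" unfolding bphase_def eq using assms by simp
qed

lemma pstart_less_block:
  assumes "\<mu> < macros n j" "\<phi> < key_bits n" "\<delta> < bct n j"
  shows "pstart \<mu> \<phi> + \<delta> < block n j" "rounds n j * n \<le> pstart \<mu> \<phi> + \<delta>"
proof -
  have "\<phi> * bct n j + \<delta> < Suc \<phi> * bct n j" using assms by simp
  also have "\<dots> \<le> key_bits n * bct n j" using assms by (intro mult_le_mono1) simp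
  finally have "pstart \<mu> \<phi> + \<delta> < rounds n j * n + Suc \<mu> * (key_bits n * bct n j)"
    by (simp add: pstart_def mstart_def)
  also have "\<dots> \<le> block n j"
    unfolding block_def using assms by (intro add_left_mono mult_le_mono1) simp
  finally show "pstart \<mu> \<phi> + \<delta> < block n j" .
  show "rounds n j * n \<le> pstart \<mu> \<phi> + \<delta>" by (simp add: pstart_def mstart_def)
qed

text \<open>The offset after a broadcast belongs to the next one, where \<open>Informed\<close> is
  recomputed. The outcome is therefore read off the preceding step.\<close>

definition reached :: "nat \<Rightarrow> nat \<Rightarrow> nat \<Rightarrow> nat set" where
  "reached \<mu> \<phi> \<delta> =
     (case \<delta> of 0 \<Rightarrow> {v\<in>A. Informed (pstart \<mu> \<phi>) v}
      | Suc \<delta>' \<Rightarrow> {v\<in>A. Informed (pstart \<mu> \<phi> + \<delta>') v \<or> Rcv (pstart \<mu> \<phi> + \<delta>') v})"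

context
  fixes \<mu> \<phi> assumes \<mu>: "\<mu> < macros n j" and \<phi>: "\<phi> < key_bits n"
begin

lemma Informed_reached:
  assumes "\<delta> < bct n j"
  shows "{v\<in>A. Informed (pstart \<mu> \<phi> + \<delta>) v} = reached \<mu> \<phi> \<delta>"
proof (cases \<delta>)
  case 0
  then show ?thesis by (simp add: reached_def)
next
  case (Suc \<delta>')
  then have d: "\<delta>' < bct n j" using assms by simp
  have "Informed (pstart \<mu> \<phi> + \<delta>) v = (Informed (pstart \<mu> \<phi> + \<delta>') v \<or> Rcv (pstart \<mu> \<phi> + \<delta>') v)" for v
    using gossip_fields_Suc(4)[OF pstart_less_block(1)[OF \<mu> \<phi> d], of v] bstep_bphase[OF \<phi> assms] Suc
    by (simp add: Informed_def informed_at_def)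
  then show ?thesis using Suc by (simp add: reached_def)
qed

lemma Sends_reached:
  assumes "\<delta> < bct n j" "v \<in> A"
  shows "Sends (pstart \<mu> \<phi> + \<delta>) v \<longleftrightarrow> v \<in> reached \<mu> \<phi> \<delta> \<inter> bcast_set n \<delta>"
  using Informed_reached[OF assms(1)] assms(2) pstart_less_block(2)[OF \<mu> \<phi> assms(1)] bstep_bphase(1)[OF \<phi> assms(1)]
  by (auto simp: Sends_def)

lemma reached_subset: "reached \<mu> \<phi> \<delta> \<subseteq> A"
  by (auto simp: reached_def split: nat.split)

lemma hears_reached:
  assumes "\<delta> < bct n j" "v \<in> A" "hears (time (pstart \<mu> \<phi> + \<delta>)) v u"
  shows "u \<in> reached \<mu> \<phi> \<delta>"
  using assms Sends_reached[OF assms(1)] hears_time[OF pstart_less_block(1)[OF \<mu> \<phi> assms(1)]] by blast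

lemma reached_Suc:
  assumes "\<delta> < bct n j"
  shows "reached \<mu> \<phi> (Suc \<delta>) = reached \<mu> \<phi> \<delta> \<union>
      {v\<in>A. v \<notin> reached \<mu> \<phi> \<delta> \<inter> bcast_set n \<delta> \<and>
        (\<exists>!u. u \<in> reached \<mu> \<phi> \<delta> \<inter> bcast_set n \<delta> \<and> (u, v) \<in> E)}"
proof -
  have R: "Rcv (pstart \<mu> \<phi> + \<delta>) v \<longleftrightarrow> v \<notin> reached \<mu> \<phi> \<delta> \<inter> bcast_set n \<delta> \<and>
        (\<exists>!u. u \<in> reached \<mu> \<phi> \<delta> \<inter> bcast_set n \<delta> \<and> (u, v) \<in> E)" if v: "v \<in> A" for v
  proof -
    note h = hears_time[OF pstart_less_block(1)[OF \<mu> \<phi> assms] v] and S = Sends_reached[OF assms]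
    define P where "P u \<longleftrightarrow> u \<in> reached \<mu> \<phi> \<delta> \<inter> bcast_set n \<delta> \<and> (u, v) \<in> E" for u
    have P: "u \<in> A \<and> (u, v) \<in> E \<and> Sends (pstart \<mu> \<phi> + \<delta>) u \<longleftrightarrow> P u" for u
      using S reached_subset by (auto simp: P_def)
    then have "hears (time (pstart \<mu> \<phi> + \<delta>)) v u \<longleftrightarrow>
        \<not> Sends (pstart \<mu> \<phi> + \<delta>) v \<and> P u \<and> (\<forall>u'. P u' \<longrightarrow> u' = u)" for u
      unfolding h by (auto simp: P[symmetric])
    then have "Rcv (pstart \<mu> \<phi> + \<delta>) v \<longleftrightarrow> \<not> Sends (pstart \<mu> \<phi> + \<delta>) v \<and> (\<exists>!u. P u)"
      by (auto simp: Rcv_def Ex1_def)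
    then show ?thesis using S[OF v] by (simp add: P_def)
  qed
  have "reached \<mu> \<phi> (Suc \<delta>) = {v\<in>A. Informed (pstart \<mu> \<phi> + \<delta>) v} \<union> {v\<in>A. Rcv (pstart \<mu> \<phi> + \<delta>) v}"
    by (auto simp: reached_def)
  also have "{v\<in>A. Rcv (pstart \<mu> \<phi> + \<delta>) v} = {v\<in>A. v \<notin> reached \<mu> \<phi> \<delta> \<inter> bcast_set n \<delta> \<and>
        (\<exists>!u. u \<in> reached \<mu> \<phi> \<delta> \<inter> bcast_set n \<delta> \<and> (u, v) \<in> E)}"
    using R by blast
  finally show ?thesis by (simp only: Informed_reached[OF assms])
qed

lemma reached_all: "reached \<mu> \<phi> (bct n j) = (if reached \<mu> \<phi> 0 = {} then {} else A)"
proof (cases "reached \<mu> \<phi> 0 = {}")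
  case True
  have "\<delta> \<le> bct n j \<Longrightarrow> reached \<mu> \<phi> \<delta> = {}" for \<delta>
  proof (induction \<delta>)
    case (Suc \<delta>)
    then show ?case using reached_Suc[of \<delta>] by (simp add: Ex1_def)
  qed (simp add: True)
  then show ?thesis using True by simp
next
  case False
  interpret broadcast n E A "reached \<mu> \<phi>" "2 ^ j"
    using A_subset A_card A_sc False reached_subset reached_Suc by unfold_locales (auto simp: bct_def)
  show ?thesis using all_informed False by (simp add: bct_def)
qed

lemma Key_Bits_phase:
  assumes "\<delta> < bct n j"
  shows "Key (pstart \<mu> \<phi> + \<delta>) v = Key (pstart \<mu> \<phi>) v \<and> Bits (pstart \<mu> \<phi> + \<delta>) v = Bits (pstart \<mu> \<phi>) v"
  using assms
proof (induction \<delta>)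
  case (Suc \<delta>)
  then have d: "\<delta> < bct n j" by simp
  have "bstep n j (pstart \<mu> \<phi> + \<delta>) \<noteq> bct n j - 1" using bstep_bphase(1)[OF \<phi> d] Suc.prems by simp
  then show ?case
    using gossip_fields_Suc(2,3)[OF pstart_less_block(1)[OF \<mu> \<phi> d], of v] bstep_bphase[OF \<phi> Suc.prems] Suc.IH d
    by (simp add: Key_def Bits_def key_at_def bits_at_def)
qed simp

text \<open>A broadcast reaches all of \<open>A\<close> or, without a source, nobody, so all nodes
  append the same bit.\<close>

lemma Key_Bits_next:
  assumes "Suc \<phi> < key_bits n" "v \<in> A"
  shows "Key (pstart \<mu> (Suc \<phi>)) v = Key (pstart \<mu> \<phi>) v"
    "Bits (pstart \<mu> (Suc \<phi>)) v = 2 * Bits (pstart \<mu> \<phi>) v + of_bool (reached \<mu> \<phi> 0 \<noteq> {})"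
proof -
  obtain D where D: "bct n j = Suc D" using bct_pos[of n j] gr0_conv_Suc by blast
  then have d: "D < bct n j" by simp
  have t: "pstart \<mu> (Suc \<phi>) = Suc (pstart \<mu> \<phi> + D)" by (simp add: pstart_Suc D)
  have "Informed (pstart \<mu> \<phi> + D) v \<or> Rcv (pstart \<mu> \<phi> + D) v \<longleftrightarrow> v \<in> reached \<mu> \<phi> (bct n j)"
    using assms by (simp add: reached_def D)
  also have "\<dots> \<longleftrightarrow> reached \<mu> \<phi> 0 \<noteq> {}" using reached_all assms by simp
  finally have r: "Informed (pstart \<mu> \<phi> + D) v \<or> Rcv (pstart \<mu> \<phi> + D) v \<longleftrightarrow> reached \<mu> \<phi> 0 \<noteq> {}" .
  have b: "bphase n j (pstart \<mu> (Suc \<phi>)) = Suc \<phi>"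
    using bstep_bphase(2)[OF assms(1) bct_pos, of \<mu>] by simp
  note g = gossip_fields_Suc(2,3)[OF pstart_less_block(1)[OF \<mu> \<phi> d], of v, folded t]
  show "Key (pstart \<mu> (Suc \<phi>)) v = Key (pstart \<mu> \<phi>) v"
    using g(1) b Key_Bits_phase[OF d, of v] by (simp add: Key_def key_at_def)
  have "Bits (pstart \<mu> (Suc \<phi>)) v = bits (st (time (pstart \<mu> (Suc \<phi>))) v) j"
    using b by (simp add: Bits_def bits_at_def)
  then show "Bits (pstart \<mu> (Suc \<phi>)) v = 2 * Bits (pstart \<mu> \<phi>) v + of_bool (reached \<mu> \<phi> 0 \<noteq> {})"
    using g(2) r Key_Bits_phase[OF d, of v] bstep_bphase(1)[OF \<phi> d] D by simp
qed

lemma reached_0: "reached \<mu> \<phi> 0 =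
    {v\<in>A. Key (pstart \<mu> \<phi>) v div 2 ^ (key_bits n - 1 - \<phi>) = 2 * Bits (pstart \<mu> \<phi>) v + 1}"
  using bstep_bphase[OF \<phi> bct_pos, of \<mu>] by (simp add: reached_def Informed_def informed_at_def Key_def Bits_def)

text \<open>A newly reached node has heard a node reached before, and messages carry everything the
  sender knows; with a single source all chains start at \<open>w\<close>.\<close>

lemma source_knowledge_spreads:
  assumes "reached \<mu> \<phi> 0 = {w}" "\<delta> \<le> bct n j" "v \<in> reached \<mu> \<phi> \<delta>"
  shows "V (pstart \<mu> \<phi>) w \<subseteq> V (pstart \<mu> \<phi> + \<delta>) v"
  using assms(2,3)
proof (induction \<delta> arbitrary: v)
  case 0
  then show ?case using assms(1) by simp
next
  case (Suc \<delta>)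
  then have d: "\<delta> < bct n j" and vA: "v \<in> A" using reached_subset by auto
  consider "v \<in> reached \<mu> \<phi> \<delta>" | "Rcv (pstart \<mu> \<phi> + \<delta>) v"
    using Suc.prems(2) Informed_reached[OF d] by (auto simp: reached_def)
  then show ?case
  proof cases
    case 1
    then show ?thesis using Suc.IH[of v] d V_mono[of "pstart \<mu> \<phi> + \<delta>" "pstart \<mu> \<phi> + Suc \<delta>" v] by simp
  next
    case 2
    then obtain u where u: "hears (time (pstart \<mu> \<phi> + \<delta>)) v u" by (auto simp: Rcv_def)
    from Suc.IH[OF _ hears_reached[OF d vA u]] V_hears[OF u] d show ?thesis by simp
  qed
qed

end

text \<open>Labels are below \<open>n\<close>, so the amount of knowledge is compared first and the
  label breaks ties.\<close>

definition rank :: "nat \<Rightarrow> nat \<Rightarrow> nat" where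
  "rank \<mu> v = 2 * (card (V (mstart \<mu>) v) * n + v) + 1"

definition best :: "nat \<Rightarrow> nat" where
  "best \<mu> = Max (rank \<mu> ` A)"

lemma rank_le_best: "v \<in> A \<Longrightarrow> rank \<mu> v \<le> best \<mu>"
  using finite_A by (simp add: best_def)

lemma ex_best: "\<exists>w\<in>A. rank \<mu> w = best \<mu>"
proof -
  have "best \<mu> \<in> rank \<mu> ` A" unfolding best_def using finite_A A_ne by (intro Max_in) auto
  then show ?thesis by auto
qed

text \<open>There are at most \<open>n * n\<close> pairs, so the key before the final doubling is
  below \<open>(n + 1) ^ 3\<close> and fits into \<open>3 * lg n\<close> bits; the odd last digit
  takes one more.\<close>

lemma best_less: "best \<mu> < 2 ^ key_bits n"
proof -
  obtain w where w: "w \<in> A" "rank \<mu> w = best \<mu>" using ex_best by blast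
  have "V (mstart \<mu>) w \<subseteq> {..<n} \<times> {..<n}" using W_T[OF w(1)] T_subset by (auto simp: V_def)
  then have "card (V (mstart \<mu>) w) \<le> n * n"
    using card_mono[of "{..<n} \<times> {..<n}"] by (fastforce simp: card_cartesian_product)
  then have "card (V (mstart \<mu>) w) * n + w < n * n * n + n"
    using w A_subset by (intro add_le_less_mono mult_le_mono1) auto
  also have "\<dots> \<le> (n + 1) ^ 3" by (simp add: power3_eq_cube algebra_simps)
  also have "\<dots> \<le> (2 ^ lg n) ^ 3" using less_two_power_lg[of n] by (intro power_mono) auto
  also have "\<dots> = 2 ^ (3 * lg n)" by (simp add: power_mult[symmetric] mult.commute)
  finally show ?thesis using w by (simp add: rank_def key_bits_def)
qed

text \<open>No rank exceeds \<open>best \<mu>\<close>, so some key continues its prefix with a 1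
  exactly if the next bit of \<open>best \<mu>\<close> is 1, and the broadcast tells
  everyone.\<close>

lemma election_invariant:
  assumes \<mu>: "\<mu> < macros n j" and "\<phi> < key_bits n" "v \<in> A"
  shows "Key (pstart \<mu> \<phi>) v = rank \<mu> v \<and> Bits (pstart \<mu> \<phi>) v = best \<mu> div 2 ^ (key_bits n - \<phi>)"
  using assms(2,3)
proof (induction \<phi> arbitrary: v)
  case 0
  have "bstep n j (pstart \<mu> 0) = 0" "bphase n j (pstart \<mu> 0) = 0"
    using bstep_bphase[OF key_bits_pos bct_pos, of \<mu>] by simp_all
  then show ?case using best_less[of \<mu>]
    by (simp add: Key_def Bits_def key_at_def bits_at_def rank_def V_def W_def pstart_0)
next
  case (Suc \<phi>)
  then have \<phi>: "\<phi> < key_bits n" by simp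
  define e where "e = key_bits n - 1 - \<phi>"
  have e: "key_bits n - \<phi> = Suc e" "key_bits n - Suc \<phi> = e" using \<phi> by (auto simp: e_def)
  define p where "p = best \<mu> div 2 ^ Suc e"
  have p: "p = best \<mu> div 2 ^ e div 2" unfolding p_def power_Suc2 div_mult2_eq ..
  have reach: "reached \<mu> \<phi> 0 = {v\<in>A. rank \<mu> v div 2 ^ e = 2 * p + 1}"
    using Suc.IH[OF \<phi>] by (auto simp: reached_0[OF \<mu> \<phi>] e e_def[symmetric] p_def)
  have "2 * p + of_bool (reached \<mu> \<phi> 0 \<noteq> {}) = best \<mu> div 2 ^ e"
  proof (cases "best \<mu> div 2 ^ e = 2 * p + 1")
    case True
    then show ?thesis using ex_best[of \<mu>] reach by auto
  next
    case False
    then have b: "best \<mu> div 2 ^ e = 2 * p" using div_mult_mod_eq[of "best \<mu> div 2 ^ e" 2] mod2_eq_if[of "best \<mu> div 2 ^ e"]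
      by (simp add: p[symmetric] split: if_splits)
    then have "rank \<mu> v div 2 ^ e \<le> 2 * p" if "v \<in> A" for v
      using div_le_mono[OF rank_le_best[OF that, of \<mu>], of "2 ^ e"] by simp
    then have "reached \<mu> \<phi> 0 = {}" using reach by force
    then show ?thesis using b by simp
  qed
  then show ?case
    using Key_Bits_next[OF \<mu> \<phi> Suc.prems] Suc.IH[OF \<phi> Suc.prems(2)] by (simp add: e p_def)
qed

text \<open>In the last broadcast whole keys are compared with
  \<open>2 * (best \<mu> div 2) + 1\<close>, which equals the odd number \<open>best \<mu>\<close>.
  Ranks determine labels modulo \<open>n\<close>, so the source is unique.\<close>

lemma elected:
  assumes \<mu>: "\<mu> < macros n j"
  shows "\<exists>w\<in>A. rank \<mu> w = best \<mu> \<and> reached \<mu> (key_bits n - 1) 0 = {w}"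
proof -
  obtain w where w: "w \<in> A" "rank \<mu> w = best \<mu>" using ex_best by blast
  define \<phi> where "\<phi> = key_bits n - 1"
  have \<phi>: "\<phi> < key_bits n" "key_bits n - 1 - \<phi> = 0" "key_bits n - \<phi> = 1" "key_bits n - Suc \<phi> = 0"
    using key_bits_pos[of n] by (simp_all add: \<phi>_def)
  have "odd (best \<mu>)" using w(2) by (metis rank_def odd_two_times_div_two_succ even_add even_mult_iff even_numeral odd_one)
  then have "2 * (best \<mu> div 2) + 1 = best \<mu>" by simp
  then have "reached \<mu> \<phi> 0 = {v\<in>A. rank \<mu> v = best \<mu>}"
    using election_invariant[OF \<mu> \<phi>(1)] by (auto simp: reached_0[OF \<mu> \<phi>(1)] \<phi>)
  also have "\<dots> = {w}"
  proof -
    have "v = w" if "v \<in> A" "rank \<mu> v = best \<mu>" for v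
    proof -
      have "card (V (mstart \<mu>) v) * n + v = card (V (mstart \<mu>) w) * n + w"
        using that w by (simp add: rank_def)
      then have "(card (V (mstart \<mu>) v) * n + v) mod n = (card (V (mstart \<mu>) w) * n + w) mod n" by simp
      moreover have "v < n" "w < n" using that w A_subset by auto
      ultimately show ?thesis by simp
    qed
    then show ?thesis using w by blast
  qed
  finally show ?thesis using w by (auto simp: \<phi>_def)
qed

lemma macro_step:
  assumes \<mu>: "\<mu> < macros n j"
  shows "\<exists>w\<in>A. (\<forall>v\<in>A. card (V (mstart \<mu>) v) \<le> card (V (mstart \<mu>) w)) \<and>
    (\<forall>v\<in>A. V (mstart \<mu>) w \<subseteq> V (mstart (Suc \<mu>)) v)"
proof -
  obtain w where w: "w \<in> A" "rank \<mu> w = best \<mu>" "reached \<mu> (key_bits n - 1) 0 = {w}"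
    using elected[OF \<mu>] by blast
  define \<phi> where "\<phi> = key_bits n - 1"
  have \<phi>: "\<phi> < key_bits n" "Suc \<phi> = key_bits n" using key_bits_pos[of n] by (simp_all add: \<phi>_def)
  have "card (V (mstart \<mu>) v) \<le> card (V (mstart \<mu>) w)" if v: "v \<in> A" for v
  proof -
    have "card (V (mstart \<mu>) v) * n + v \<le> card (V (mstart \<mu>) w) * n + w"
      using rank_le_best[OF v, of \<mu>] w by (simp add: rank_def)
    moreover have "w < n" using w A_subset by auto
    ultimately have "card (V (mstart \<mu>) v) * n < (card (V (mstart \<mu>) w) + 1) * n" by simp
    then have "card (V (mstart \<mu>) v) < card (V (mstart \<mu>) w) + 1" by (simp only: mult_less_cancel2)
    then show ?thesis by simp
  qed
  moreover have "V (mstart \<mu>) w \<subseteq> V (mstart (Suc \<mu>)) v" if v: "v \<in> A" for v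
  proof -
    have "reached \<mu> \<phi> (bct n j) = A" using reached_all[OF \<mu> \<phi>(1)] w by (simp add: \<phi>_def)
    then have "V (pstart \<mu> \<phi>) w \<subseteq> V (pstart \<mu> \<phi> + bct n j) v"
      using source_knowledge_spreads[OF \<mu> \<phi>(1)] w v by (simp add: \<phi>_def)
    moreover have "pstart \<mu> \<phi> + bct n j = mstart (Suc \<mu>)"
      by (simp add: mstart_Suc \<phi>(2)[symmetric] pstart_Suc)
    moreover have "V (mstart \<mu>) w \<subseteq> V (pstart \<mu> \<phi>) w" by (rule V_mono) (simp add: pstart_def)
    ultimately show ?thesis by auto
  qed
  ultimately show ?thesis using w by blast
qed

section \<open>Decay of the missing knowledge\<close>

definition missing :: "nat \<Rightarrow> (nat \<times> nat) set" where
  "missing \<mu> = {x\<in>T. \<exists>v\<in>A. x \<notin> V (mstart \<mu>) v}"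

text \<open>A missing item is not held by all, so after the round robins more than
  \<open>rounds n j\<close> nodes hold it. Double counting bounds from below the most missing items
  held by one node. Non-missing items are common to all, so the elected node attains this maximum,
  and its items cease to be missing.\<close>

lemma missing_decreases:
  assumes \<mu>: "\<mu> < macros n j"
  shows "2 ^ j * card (missing (Suc \<mu>)) + card (missing \<mu>) * (rounds n j + 1) \<le> 2 ^ j * card (missing \<mu>)"
proof -
  obtain w where w: "w \<in> A" "\<And>v. v \<in> A \<Longrightarrow> card (V (mstart \<mu>) v) \<le> card (V (mstart \<mu>) w)"
    "\<And>v. v \<in> A \<Longrightarrow> V (mstart \<mu>) w \<subseteq> V (mstart (Suc \<mu>)) v"
    using macro_step[OF \<mu>] by blast
  define Q where "Q = T - missing \<mu>"
  define g where "g = card (V (mstart \<mu>) w \<inter> missing \<mu>)"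
  have finM: "finite (missing \<mu>)" using finite_T by (simp add: missing_def)
  have VT: "V (mstart \<mu>) v \<subseteq> T" if "v \<in> A" for v using W_T[OF that] by (simp add: V_def)
  have split: "card (V (mstart \<mu>) v) = card Q + card (V (mstart \<mu>) v \<inter> missing \<mu>)" if v: "v \<in> A" for v
  proof -
    have "V (mstart \<mu>) v = Q \<union> (V (mstart \<mu>) v \<inter> missing \<mu>)"
      using v VT[OF v] by (auto simp: Q_def missing_def)
    moreover have "Q \<inter> (V (mstart \<mu>) v \<inter> missing \<mu>) = {}" by (auto simp: Q_def)
    moreover have "finite Q" "finite (V (mstart \<mu>) v \<inter> missing \<mu>)" using finite_T finM by (simp_all add: Q_def)
    ultimately show ?thesis by (metis card_Un_disjoint)
  qed
  have le_g: "card (V (mstart \<mu>) v \<inter> missing \<mu>) \<le> g" if v: "v \<in> A" for v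
    using w(2)[OF v] split[OF v] split[OF w(1)] by (simp add: g_def)
  have many: "rounds n j + 1 \<le> card {v\<in>A. x \<in> V (mstart \<mu>) v}" if x: "x \<in> missing \<mu>" for x
  proof -
    have "holders (rounds n j * n) x \<subseteq> holders (mstart \<mu>) x" by (rule holders_mono) (simp add: mstart_def)
    then have "card (holders (rounds n j * n) x) \<le> card (holders (mstart \<mu>) x)"
      by (rule card_mono[OF finite_holders])
    moreover have "min (rounds n j + 1) (card A) \<le> card (holders (rounds n j * n) x)"
      using x by (intro card_holders_rounds) (auto simp: missing_def)
    moreover have "holders (mstart \<mu>) x \<subset> A" using x by (auto simp: holders_def missing_def)
    then have "card (holders (mstart \<mu>) x) < card A" by (rule psubset_card_mono[OF finite_A])
    ultimately show ?thesis by (simp add: holders_def min_def split: if_splits)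
  qed
  have "card (missing \<mu>) * (rounds n j + 1) = (\<Sum>x\<in>missing \<mu>. rounds n j + 1)" by simp
  also have "\<dots> \<le> (\<Sum>x\<in>missing \<mu>. card {v\<in>A. x \<in> V (mstart \<mu>) v})"
    by (rule sum_mono) (rule many)
  also have "\<dots> = (\<Sum>v\<in>A. card {x\<in>missing \<mu>. x \<in> V (mstart \<mu>) v})"
    by (rule double_counting[OF finM finite_A])
  also have "\<dots> \<le> (\<Sum>v\<in>A. g)"
  proof (rule sum_mono)
    fix v assume "v \<in> A"
    moreover have "{x\<in>missing \<mu>. x \<in> V (mstart \<mu>) v} = V (mstart \<mu>) v \<inter> missing \<mu>" by auto
    ultimately show "card {x\<in>missing \<mu>. x \<in> V (mstart \<mu>) v} \<le> g" using le_g by simp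
  qed
  also have "\<dots> \<le> 2 ^ j * g" using A_card by simp
  finally have 1: "card (missing \<mu>) * (rounds n j + 1) \<le> 2 ^ j * g" .
  have "mstart \<mu> \<le> mstart (Suc \<mu>)" by (simp add: mstart_def)
  then have "missing (Suc \<mu>) \<subseteq> missing \<mu> - V (mstart \<mu>) w \<inter> missing \<mu>"
    unfolding missing_def using w(3) V_mono[of "mstart \<mu>" "mstart (Suc \<mu>)"] by blast
  then have "card (missing (Suc \<mu>)) \<le> card (missing \<mu> - V (mstart \<mu>) w \<inter> missing \<mu>)"
    using finM by (intro card_mono) auto
  also have "\<dots> = card (missing \<mu>) - g"
    unfolding g_def using finM by (intro card_Diff_subset) auto
  finally have "card (missing (Suc \<mu>)) \<le> card (missing \<mu>) - g" .
  moreover have "g \<le> card (missing \<mu>)" unfolding g_def using finM by (intro card_mono) auto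
  ultimately have "card (missing (Suc \<mu>)) + g \<le> card (missing \<mu>)" by simp
  then have "2 ^ j * (card (missing (Suc \<mu>)) + g) \<le> 2 ^ j * card (missing \<mu>)" by simp
  then show ?thesis using 1 by (simp add: add_mult_distrib2)
qed

lemma card_missing_le:
  "\<mu> \<le> macros n j \<Longrightarrow> real (card (missing \<mu>)) \<le> (real n)\<^sup>2 * exp (- (real (rounds n j + 1) / 2 ^ j)) ^ \<mu>"
proof (induction \<mu>)
  case 0
  have "card (missing 0) \<le> card ({..<n} \<times> {..<n})"
    using T_subset by (intro card_mono) (auto simp: missing_def)
  then have "card (missing 0) \<le> n\<^sup>2" by (simp add: card_cartesian_product power2_eq_square)
  then show ?case by (simp flip: of_nat_power)
next
  case (Suc \<mu>)
  define y where "y = real (rounds n j + 1) / 2 ^ j"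
  have "2 ^ j * card (missing (Suc \<mu>)) + card (missing \<mu>) * (rounds n j + 1) \<le> 2 ^ j * card (missing \<mu>)"
    using Suc by (intro missing_decreases) simp
  then have "real (2 ^ j * card (missing (Suc \<mu>)) + card (missing \<mu>) * (rounds n j + 1)) \<le> real (2 ^ j * card (missing \<mu>))"
    using of_nat_le_iff by blast
  then have "real (card (missing (Suc \<mu>))) \<le> card (missing \<mu>) * (1 - y)"
    by (simp add: y_def field_simps)
  also have "\<dots> \<le> card (missing \<mu>) * exp (- y)"
    using exp_ge_add_one_self[of "- y"] by (intro mult_left_mono) auto
  also have "\<dots> \<le> (real n)\<^sup>2 * exp (- y) ^ \<mu> * exp (- y)"
    using Suc by (intro mult_right_mono) (auto simp: y_def)
  finally show ?case by (simp add: y_def mult_ac)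
qed

text \<open>The number of elections makes the total decay at least \<open>exp (2 * lg n)\<close>,
  which exceeds \<open>n * n\<close>; fewer than one item can then be missing.\<close>

theorem gossip_completes:
  assumes "v \<in> A"
  shows "T \<subseteq> W (tb + channels n * block n j) v"
proof -
  define r where "r = rounds n j + 1"
  define M where "M = macros n j"
  \<comment> \<open>Rounding the quotient up in \<open>macros\<close> ensures that the elections per
    \<open>2 * lg n\<close>, times \<open>r\<close>, reach \<open>2 ^ j\<close>.\<close>
  have "2 ^ j \<le> (2 ^ j div r + 1) * r"
  proof -
    have "(2::nat) ^ j = 2 ^ j div r * r + 2 ^ j mod r" by simp
    also have "\<dots> \<le> 2 ^ j div r * r + r" by (simp add: r_def less_imp_le)
    finally show ?thesis by simp
  qed
  then have "2 * lg n * 2 ^ j \<le> 2 * lg n * ((2 ^ j div r + 1) * r)" by (rule mult_le_mono2)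
  also have "\<dots> = M * r" by (simp add: M_def macros_def r_def algebra_simps)
  finally have "real (2 * lg n * 2 ^ j) \<le> real (M * r)" using of_nat_le_iff by blast
  then have "real (2 * lg n) \<le> M * (r / 2 ^ j)" by (simp add: field_simps)
  then have "exp (- (real r / 2 ^ j)) ^ M \<le> exp (- real (2 * lg n))"
    by (simp flip: exp_of_nat_mult)
  moreover have "exp (real (2 * lg n)) = (exp 1 ^ lg n)\<^sup>2"
    using exp_of_nat_mult[of "2 * lg n" "1::real"] by (simp add: power_mult[symmetric] mult.commute)
  moreover have "real n < exp 1 ^ lg n"
  proof -
    have "real n < 2 ^ lg n" using less_two_power_lg[of n] by (simp flip: of_nat_less_iff)
    also have "\<dots> \<le> exp 1 ^ lg n" using exp_ge_add_one_self[of "1::real"] by (intro power_mono) auto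
    finally show ?thesis .
  qed
  then have "(real n)\<^sup>2 < (exp 1 ^ lg n)\<^sup>2" by (intro power_strict_mono) auto
  ultimately have "(real n)\<^sup>2 * exp (- (real r / 2 ^ j)) ^ M < 1"
  proof -
    assume 1: "exp (- (real r / 2 ^ j)) ^ M \<le> exp (- real (2 * lg n))"
      and 2: "exp (real (2 * lg n)) = (exp 1 ^ lg n)\<^sup>2" and 3: "(real n)\<^sup>2 < (exp 1 ^ lg n)\<^sup>2"
    have "(real n)\<^sup>2 * exp (- (real r / 2 ^ j)) ^ M \<le> (real n)\<^sup>2 * exp (- real (2 * lg n))"
      using 1 by (intro mult_left_mono) auto
    also have "\<dots> < exp (real (2 * lg n)) * exp (- real (2 * lg n))"
      using 2 3 by (intro mult_strict_right_mono) simp_all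
    finally show ?thesis by (simp flip: exp_add)
  qed
  then have "card (missing M) = 0" using card_missing_le[of M] by (simp add: M_def r_def)
  moreover have "finite (missing M)" using finite_T by (simp add: missing_def)
  ultimately have "missing M = {}" by simp
  then have "T \<subseteq> V (mstart M) v" using assms by (auto simp: missing_def)
  then show ?thesis by (simp add: V_def mstart_def time_def M_def block_def)
qed

end

lemma block_pos: "0 < block n j"
  using bct_pos[of n j] key_bits_pos[of n] lg_pos[of n] by (simp add: block_def macros_def)

lemma le_rt_square: "n \<le> rt n * rt n"
  using Suc_floor_sqrt_power2_gt[of n] by (simp add: rt_def power2_eq_square)

text \<open>The choice of \<open>rounds\<close> balances the two costs: the round robins take at
  most \<open>2 ^ j * (lg n)\<^sup>2 * rt n\<close> slots, and
  \<open>q * L\<^sup>2 \<le> rt n\<close> bounds the elections alike. The extra \<open>+ 1\<close>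
  in \<open>macros\<close> causes the term \<open>(lg n) ^ 4\<close>.\<close>

lemma block_le: "block n j \<le> 3073 * 2 ^ j * ((lg n)\<^sup>2 * rt n + (lg n) ^ 4)"
proof -
  define L where "L = lg n"
  define r where "r = rounds n j"
  define q where "q = 2 ^ j div (r + 1)"
  have L: "1 \<le> L" using lg_pos[of n] by (simp add: L_def)
  have "r * n \<le> r * (rt n * rt n)" using le_rt_square by simp
  also have "\<dots> = (2 ^ j * L\<^sup>2 div rt n * rt n) * rt n" by (simp add: r_def rounds_def L_def)
  also have "\<dots> \<le> 2 ^ j * L\<^sup>2 * rt n" by (intro mult_le_mono1 div_times_less_eq_dividend)
  finally have 1: "r * n \<le> 2 ^ j * (L\<^sup>2 * rt n)" by (simp add: mult.assoc)
  have "2 ^ j * L\<^sup>2 < (2 ^ j * L\<^sup>2 div rt n + 1) * rt n"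
    using dividend_less_div_times[of "rt n" "2 ^ j * L\<^sup>2"] by (simp add: rt_def)
  then have "2 ^ j * L\<^sup>2 < (r + 1) * rt n" by (simp add: r_def rounds_def L_def)
  moreover have "q * (r + 1) * L\<^sup>2 \<le> 2 ^ j * L\<^sup>2"
    unfolding q_def by (intro mult_le_mono1 div_times_less_eq_dividend)
  ultimately have "q * (r + 1) * L\<^sup>2 < (r + 1) * rt n" by (rule le_less_trans[rotated])
  also have "q * (r + 1) * L\<^sup>2 = (r + 1) * (q * L\<^sup>2)" by (simp only: mult_ac)
  finally have qL: "q * L\<^sup>2 \<le> rt n" by (simp only: mult_less_cancel1 less_imp_le)
  have "macros n j * (key_bits n * bct n j) = 2 * L * (q + 1) * ((3 * L + 1) * (384 * L\<^sup>2 * 2 ^ j))"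
    by (simp add: macros_def key_bits_def bct_def bcast_time_def L_def q_def r_def)
  also have "\<dots> \<le> 2 * L * (q + 1) * ((4 * L) * (384 * L\<^sup>2 * 2 ^ j))"
    using L by (intro mult_le_mono2 mult_le_mono1) simp
  also have "\<dots> = 3072 * 2 ^ j * (L\<^sup>2 * (q * L\<^sup>2) + L ^ 4)"
    by (simp add: algebra_simps power2_eq_square power4_eq_xxxx)
  also have "\<dots> \<le> 3072 * 2 ^ j * (L\<^sup>2 * rt n + L ^ 4)"
    using qL by (intro mult_le_mono2 add_le_mono1)
  finally have "block n j \<le> 2 ^ j * (L\<^sup>2 * rt n) + 3072 * 2 ^ j * (L\<^sup>2 * rt n + L ^ 4)"
    using 1 unfolding block_def r_def[symmetric] by simp
  also have "\<dots> \<le> 3073 * 2 ^ j * (L\<^sup>2 * rt n + L ^ 4)"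
    by (simp add: algebra_simps)
  finally show ?thesis by (simp add: L_def)
qed

section \<open>Running time\<close>

context network
begin

definition scc :: "nat \<Rightarrow> nat set" where
  "scc z = {u. (u, z) \<in> E\<^sup>* \<and> (z, u) \<in> E\<^sup>*}"

lemma self_in_scc: "z \<in> scc z" by (simp add: scc_def)

lemma rtrancl_less: "(u, z) \<in> E\<^sup>* \<Longrightarrow> z < n \<Longrightarrow> u < n"
  by (induction rule: converse_rtrancl_induct) (use E_subset in auto)

lemma scc_subset: "z < n \<Longrightarrow> scc z \<subseteq> {..<n}"
  using rtrancl_less by (auto simp: scc_def)

lemma finite_scc: "z < n \<Longrightarrow> finite (scc z)"
  using finite_subset[OF scc_subset] by simp

lemma scc_eq: "v \<in> scc z \<Longrightarrow> scc v = scc z"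
  unfolding scc_def by (auto intro: rtrancl_trans)

lemma full_scc: "v \<in> scc z \<Longrightarrow> full v = full z"
  using full_mono by (auto simp: scc_def)

lemma full_subset: "v < n \<Longrightarrow> full v \<subseteq> {..<n} \<times> {..<n}"
  using E_subset rtrancl_less by (auto simp: full_def)

lemma scc_strongly_connected: "strongly_connected_on E (scc z)"
  unfolding strongly_connected_on_def
proof
  fix x assume x: "x \<in> scc z"
  define d where "d u = (LEAST k. (u, x) \<in> E ^^ k)" for u
  have "\<exists>w\<in>scc z. (u, w) \<in> E \<and> d w < d u" if u: "u \<in> scc z" "u \<noteq> x" for u
  proof -
    have "(u, x) \<in> E\<^sup>*" using u x by (auto simp: scc_def)
    then have "(u, x) \<in> E ^^ d u" unfolding d_def by (metis LeastI rtrancl_imp_relpow)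
    moreover have "d u \<noteq> 0"
    proof
      assume "d u = 0"
      with calculation u(2) show False by simp
    qed
    then obtain k where k: "d u = Suc k" using not0_implies_Suc by blast
    ultimately obtain w where w: "(u, w) \<in> E" "(w, x) \<in> E ^^ k" by (metis relpow_Suc_E2)
    then have "d w \<le> k" unfolding d_def by (intro Least_le)
    moreover have "(w, x) \<in> E\<^sup>*" using w by (metis relpow_imp_rtrancl)
    then have "w \<in> scc z" using w(1) u x unfolding scc_def by (auto intro: rtrancl_trans rtrancl_into_rtrancl)
    ultimately show ?thesis using w k by (intro bexI[of _ w]) auto
  qed
  then show "\<exists>d :: nat \<Rightarrow> nat. \<forall>u\<in>scc z. u \<noteq> x \<longrightarrow> (\<exists>w\<in>scc z. (u, w) \<in> E \<and> d w < d u)" by blast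
qed

text \<open>Completeness outside keeps the gossiping channels undisturbed, while delivery makes the
  component jointly hold all it has to learn.\<close>

definition ready :: "nat \<Rightarrow> nat set \<Rightarrow> bool" where
  "ready t A \<longleftrightarrow> (\<forall>u v. (u, v) \<in> E \<and> v \<in> A \<and> u \<notin> A \<longrightarrow> since (st t u) \<noteq> None \<and> full u \<subseteq> W t v)"

lemma ready_mono: "ready t A \<Longrightarrow> t \<le> t' \<Longrightarrow> ready t' A"
  unfolding ready_def using W_mono[of t t'] incomplete_before[of t' _ t] by blast

text \<open>An incomplete \<open>z\<close> with fewest ancestors has only complete nodes feeding its
  component from outside. If the component is partly complete, an inner edge from a complete to an
  incomplete node is undelivered; if it is wholly incomplete but not ready, an entering edge is.
  Either edge yields a crowd.\<close>

lemma crowd_or_ready: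
  assumes t: "n \<le> t" and z0: "z0 < n" "since (st t z0) = None"
  shows "(\<exists>i\<le>lg n. (i = 0 \<or> strong_len n (i - 1) \<le> n) \<and> 2 ^ i \<le> 2 * card (crowd i t)) \<or>
    (\<exists>z<n. ready t (scc z) \<and> (\<forall>v\<in>scc z. since (st t v) = None))"
proof -
  define anc where "anc z = {u. (u, z) \<in> E\<^sup>*}" for z
  define bad where "bad z \<longleftrightarrow> z < n \<and> since (st t z) = None" for z
  obtain z where z: "bad z" "\<And>y. bad y \<Longrightarrow> card (anc z) \<le> card (anc y)"
    using ex_has_least_nat[of bad z0 "\<lambda>z. card (anc z)"] z0 bad_def by blast
  have zn: "z < n" and zi: "since (st t z) = None" using z by (auto simp: bad_def)
  have crowd: "\<exists>i\<le>lg n. (i = 0 \<or> strong_len n (i - 1) \<le> n) \<and> 2 ^ i \<le> 2 * card (crowd i t)"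
    if xy: "(x, y) \<in> E" "since (st t x) \<noteq> None" "since (st t y) = None" "\<not> full x \<subseteq> W t y" for x y
  proof -
    obtain t0 where "since (st t x) = Some t0" using xy(2) by blast
    then have "completes x t0" "t0 \<le> t" using since_completes since_SomeD by blast+
    from undelivered_crowd[OF this xy(1,3,4)] show ?thesis .
  qed
  show ?thesis
  proof (cases "\<exists>v\<in>scc z. since (st t v) \<noteq> None")
    case True
    define R where "R = {v\<in>scc z. since (st t v) \<noteq> None}"
    have "R \<subseteq> scc z" "R \<noteq> {}" using True by (auto simp: R_def)
    moreover have "z \<notin> R" using zi by (simp add: R_def)
    then have "R \<noteq> scc z" using self_in_scc by blast
    ultimately obtain x y where xy: "x \<in> R" "y \<in> scc z - R" "(x, y) \<in> E"
      using strongly_connected_on_leaving_edge[OF scc_strongly_connected] by meson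
    then have x: "since (st t x) \<noteq> None" "x \<in> scc z" and y: "since (st t y) = None" "y \<in> scc z"
      by (auto simp: R_def)
    \<comment> \<open>Nodes of one component have the same \<open>full\<close>, so a delivery from
      \<open>x\<close> would have made \<open>y\<close> complete.\<close>
    have "\<not> full y \<subseteq> W t y" using y(1) t since_None_iff[of t y] by simp
    then have "\<not> full x \<subseteq> W t y" using full_scc x(2) y(2) by simp
    then show ?thesis using crowd[OF xy(3) x(1) y(1)] by simp
  next
    case False
    show ?thesis
    proof (cases "ready t (scc z)")
      case True
      then show ?thesis using False zn by blast
    next
      case nready: False
      then obtain u v where uv: "(u, v) \<in> E" "v \<in> scc z" "u \<notin> scc z"
        "\<not> (since (st t u) \<noteq> None \<and> full u \<subseteq> W t v)" by (auto simp: ready_def)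
      have "since (st t u) \<noteq> None"
      proof
        assume "since (st t u) = None"
        then have "bad u" using uv(1) E_subset by (auto simp: bad_def)
        then have "card (anc z) \<le> card (anc u)" by (rule z(2))
        moreover have uz: "(u, z) \<in> E\<^sup>*" using converse_rtrancl_into_rtrancl[OF uv(1)] uv(2) by (simp add: scc_def)
        have "anc u \<subset> anc z"
        proof
          show "anc u \<subseteq> anc z" using uz by (auto simp: anc_def)
          have "z \<in> anc z" by (simp add: anc_def)
          moreover have "z \<notin> anc u" using uv(3) uz by (auto simp: anc_def scc_def)
          ultimately show "anc u \<noteq> anc z" by blast
        qed
        moreover have "finite (anc z)"
          by (rule finite_subset[of _ "{..<n}"]) (use rtrancl_less zn in \<open>auto simp: anc_def\<close>)
        ultimately show False using psubset_card_mono[of "anc z" "anc u"] by simp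
      qed
      moreover have "since (st t v) = None" using False uv(2) by blast
      ultimately show ?thesis using crowd[OF uv(1)] uv(4) by simp
    qed
  qed
qed

text \<open>A path from an outside ancestor \<open>x\<close> enters the component by some edge
  \<open>(u, v)\<close>, and \<open>full u\<close>, already delivered to \<open>v\<close>, contains
  the mark of \<open>x\<close>.\<close>

lemma ready_full:
  assumes z: "z < n" and t: "n \<le> t" and r: "ready t (scc z)"
  shows "full z \<subseteq> (\<Union>v\<in>scc z. W t v)"
proof -
  have col: "\<exists>v\<in>scc z. (x, x) \<in> W t v" if "(x, z) \<in> E\<^sup>*" for x
  proof (cases "x \<in> scc z")
    case True
    then show ?thesis using self_in_W by blast
  next
    case False
    from that False have "\<exists>u v. (x, u) \<in> E\<^sup>* \<and> (u, v) \<in> E \<and> u \<notin> scc z \<and> v \<in> scc z"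
    proof (induction rule: converse_rtrancl_induct)
      case base
      then show ?case using self_in_scc by blast
    next
      case (step y y')
      show ?case
      proof (cases "y' \<in> scc z")
        case True
        then show ?thesis using step by blast
      next
        case False
        with step obtain u v where "(y', u) \<in> E\<^sup>*" "(u, v) \<in> E" "u \<notin> scc z" "v \<in> scc z" by blast
        then show ?thesis using step(1) by (blast intro: converse_rtrancl_into_rtrancl)
      qed
    qed
    then obtain u v where uv: "(x, u) \<in> E\<^sup>*" "(u, v) \<in> E" "u \<notin> scc z" "v \<in> scc z" by blast
    then have "full u \<subseteq> W t v" using r by (auto simp: ready_def)
    moreover have "(x, x) \<in> full u" using uv(1) by (simp add: full_def)
    ultimately show ?thesis using uv(4) by blast
  qed
  show ?thesis
  proof
    fix p assume "p \<in> full z"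
    then obtain u x where p: "p = (u, x)" "(x, z) \<in> E\<^sup>*" "(u, x) \<in> E \<or> u = x" by (auto simp: full_def)
    then obtain v where "v \<in> scc z" "(x, x) \<in> W t v" using col by blast
    then show "p \<in> (\<Union>v\<in>scc z. W t v)" using column_in_W[OF t, of x v u] p by blast
  qed
qed

text \<open>At most one block length passes until the next block starts, and another while it runs.
  If all members were still incomplete by then, the gossiping would have been undisturbed and would
  have completed \<open>z\<close>.\<close>

lemma ready_completes:
  assumes z: "z < n" and j: "card (scc z) \<le> 2 ^ j" "j \<le> lg n" and t: "n \<le> t" and r: "ready t (scc z)"
  shows "\<exists>v\<in>scc z. since (st (t + 2 * channels n * block n j) v) \<noteq> None"
proof (rule ccontr)
  assume neg: "\<not> ?thesis"
  have "1 + lg n + j < channels n" using j by (simp add: channels_def)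
  from window_hits_slot[OF this block_pos[of n j], of "t - n"] obtain \<tau> where
    \<tau>: "t - n \<le> \<tau>" "\<tau> < t - n + channels n * block n j" "\<tau> mod channels n = 1 + lg n + j"
       "\<tau> div channels n mod block n j = 0" by (elim exE conjE)
  define tb where "tb = \<tau> + n"
  define te where "te = tb + channels n * block n j"
  have tb: "n \<le> tb" "t \<le> tb" "tb < t + channels n * block n j" using \<tau> t by (auto simp: tb_def)
  have te: "tb \<le> te" "te \<le> t + 2 * channels n * block n j" using tb by (simp_all add: te_def)
  have inc: "since (st s v) = None" if "v \<in> scc z" "s \<le> te" for v s
    using neg that te incomplete_before[of "t + 2 * channels n * block n j" v s] by simp
  have rb: "ready tb (scc z)" using ready_mono[OF r tb(2)] .
  interpret gossip_block n E "scc z" j tb "full z"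
  proof
    show "scc z \<subseteq> {..<n}" by (rule scc_subset[OF z])
    show "scc z \<noteq> {}" using self_in_scc by blast
    show "card (scc z) \<le> 2 ^ j" by (fact j(1))
    show "strongly_connected_on E (scc z)" by (rule scc_strongly_connected)
    show "n \<le> tb" by (fact tb(1))
    show "chan n tb = 1 + lg n + j" "slot n tb mod block n j = 0"
      using \<tau> by (simp_all add: chan_def slot_def tb_def)
    show "since (st tb v) = None" if "v \<in> scc z" for v using inc[OF that te(1)] .
    show "since (st tb u) \<noteq> None" if "(u, v) \<in> E" "v \<in> scc z" "u \<notin> scc z" for u v
      using rb that by (auto simp: ready_def)
    show "W s v \<subseteq> full z" if "v \<in> scc z" for s v using W_subset_full[of s v] full_scc[OF that] by simp
    show "full z \<subseteq> (\<Union>v\<in>scc z. W tb v)" by (rule ready_full[OF z tb(1) rb])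
    show "full z \<subseteq> {..<n} \<times> {..<n}" by (rule full_subset[OF z])
  qed
  have "full z \<subseteq> W te z" using gossip_completes[OF self_in_scc] by (simp add: te_def)
  moreover have "since (st te z) = None" using inc[OF self_in_scc] by simp
  ultimately show False using since_None_iff[of te z] tb te by simp
qed

definition crowded :: "nat \<Rightarrow> nat \<Rightarrow> nat set" where
  "crowded N i = {t\<in>{n..<n + N}. 2 ^ i \<le> 2 * card (crowd i t)}"

definition gossiping :: "nat \<Rightarrow> nat set \<Rightarrow> nat set" where
  "gossiping N A = {t\<in>{n..<n + N}. ready t A \<and> (\<forall>v\<in>A. since (st t v) = None)}"

text \<open>A node lies in crowds only near its unique completion time, for at most
  \<open>2 * X + 1\<close> steps, while each crowded step uses up at least \<open>2 ^ i / 2\<close>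
  nodes. Double counting leaves a factor \<open>2 ^ i\<close>, and
  \<open>strong_len n (i - 1) \<le> n\<close> keeps it at most \<open>2 * rt n\<close>.\<close>

lemma card_crowded_le:
  assumes i: "i = 0 \<or> strong_len n (i - 1) \<le> n"
  shows "card (crowded N i) \<le> 160 * n * channels n * lg n * rt n"
proof -
  define X where "X = 2 * channels n * strong_len n i"
  have fin: "finite (crowded N i)" by (simp add: crowded_def)
  have X: "1 \<le> X" using channels_pos[of n] strong_len_pos[of n i] by (simp add: X_def)
  have each: "card {t\<in>crowded N i. z \<in> crowd i t} \<le> 2 * X + 1" for z
  proof (cases "\<exists>t1. completes z t1")
    case True
    then obtain t1 where t1: "completes z t1" by blast
    have "{t\<in>crowded N i. z \<in> crowd i t} \<subseteq> {t1 - X..t1 + X}"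
    proof
      fix t assume "t \<in> {t\<in>crowded N i. z \<in> crowd i t}"
      then obtain t2 where "completes z t2" "t2 \<le> t + X" "t \<le> t2 + X" by (auto simp: crowd_def X_def)
      moreover from this have "t2 = t1" using completes_unique t1 by blast
      ultimately show "t \<in> {t1 - X..t1 + X}" by auto
    qed
    then have "card {t\<in>crowded N i. z \<in> crowd i t} \<le> card {t1 - X..t1 + X}" by (intro card_mono) auto
    then show ?thesis by simp
  next
    case False
    then have "{t\<in>crowded N i. z \<in> crowd i t} = {}" by (auto simp: crowd_def)
    then show ?thesis by (metis card.empty le0)
  qed
  have "card (crowded N i) * 2 ^ i = (\<Sum>t\<in>crowded N i. 2 ^ i)" by simp
  also have "\<dots> \<le> (\<Sum>t\<in>crowded N i. 2 * card (crowd i t))"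
    by (rule sum_mono) (simp add: crowded_def)
  also have "\<dots> = 2 * (\<Sum>t\<in>crowded N i. card {z\<in>{..<n}. z \<in> crowd i t})"
    by (simp add: sum_distrib_left crowd_def)
  also have "\<dots> = 2 * (\<Sum>z<n. card {t\<in>crowded N i. z \<in> crowd i t})"
    using double_counting[OF fin finite_lessThan[of n], of "\<lambda>t z. z \<in> crowd i t"] by simp
  also have "\<dots> \<le> 2 * (\<Sum>z<n. 2 * X + 1)" using each by (intro mult_le_mono2 sum_mono)
  also have "\<dots> \<le> 2 * (n * (5 * (X div 2)))"
  proof -
    have "even X" "1 \<le> X div 2" using X by (auto simp: X_def)
    then have "2 * X + 1 \<le> 5 * (X div 2)" by presburger
    then show ?thesis by (simp only: sum_constant card_lessThan mult_le_mono2 order_refl of_nat_id)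
  qed
  also have "X div 2 = channels n * strong_len n i" by (simp add: X_def)
  also have "2 * (n * (5 * (channels n * strong_len n i))) = (80 * n * channels n * lg n * 2 ^ i) * 2 ^ i"
  proof -
    have "(4::nat) ^ i = 2 ^ i * 2 ^ i" by (simp flip: power_mult_distrib)
    then show ?thesis by (simp add: strong_len_def)
  qed
  finally have "card (crowded N i) \<le> 80 * n * channels n * lg n * 2 ^ i" by simp
  moreover have "2 ^ i \<le> 2 * rt n"
  proof (cases i)
    case 0
    then show ?thesis by (simp add: rt_def)
  next
    case (Suc a)
    then have "8 * lg n * 4 ^ a \<le> n" using i by (simp add: strong_len_def)
    moreover have "4 ^ a \<le> 8 * lg n * 4 ^ a" using lg_pos[of n] by simp
    ultimately have "4 ^ a \<le> rt n * rt n" using le_rt_square[of n] by linarith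
    then have "(2 ^ a)\<^sup>2 \<le> (rt n)\<^sup>2" by (simp add: power2_eq_square flip: power_mult_distrib)
    then have "2 ^ a \<le> rt n" by (simp add: power2_le_iff_abs_le)
    then show ?thesis using Suc by simp
  qed
  then have "80 * n * channels n * lg n * 2 ^ i \<le> 80 * n * channels n * lg n * (2 * rt n)"
    by (rule mult_le_mono2)
  ultimately have "card (crowded N i) \<le> 80 * n * channels n * lg n * (2 * rt n)" by (rule le_trans)
  then show ?thesis by (simp add: mult_ac)
qed

text \<open>Within two blocks of the first such step some member completes, which ends the set for
  good. Rounding the size \<open>s\<close> up to a power of two at most doubles it, hence
  \<open>12292 = 2 * 3073 * 2\<close>.\<close>

lemma card_gossiping_le:
  assumes z: "z < n"
  shows "card (gossiping N (scc z)) \<le> 12292 * channels n * ((lg n)\<^sup>2 * rt n + (lg n) ^ 4) * card (scc z)"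
proof (cases "gossiping N (scc z) = {}")
  case True
  then show ?thesis by simp
next
  case False
  define s where "s = card (scc z)"
  have s: "1 \<le> s" using self_in_scc finite_scc[OF z] by (metis s_def One_nat_def Suc_leI card_gt_0_iff empty_iff)
  define j where "j = floor_log s + 1"
  have j: "s \<le> 2 ^ j" "2 ^ j \<le> 2 * s"
    using floor_log_exp2_gt[of s] floor_log_exp2_le[of s] s by (simp_all add: j_def less_imp_le)
  have "s \<le> n" using card_mono[OF _ scc_subset[OF z]] by (simp add: s_def)
  then have jl: "j \<le> lg n" using floor_log_le_iff by (auto simp: j_def lg_def)
  define t0 where "t0 = Min (gossiping N (scc z))"
  have fin: "finite (gossiping N (scc z))" by (simp add: gossiping_def)
  have t0: "t0 \<in> gossiping N (scc z)" "\<And>t. t \<in> gossiping N (scc z) \<Longrightarrow> t0 \<le> t"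
    using fin False by (auto simp: t0_def)
  obtain v where v: "v \<in> scc z" "since (st (t0 + 2 * channels n * block n j) v) \<noteq> None"
    using ready_completes[OF z _ jl, of t0] t0(1) j by (auto simp: gossiping_def s_def)
  have "gossiping N (scc z) \<subseteq> {t0..<t0 + 2 * channels n * block n j}"
  proof
    fix t assume t: "t \<in> gossiping N (scc z)"
    then have "since (st t v) = None" using v by (simp add: gossiping_def)
    from incomplete_before[OF this, of "t0 + 2 * channels n * block n j"] v(2)
    have "t < t0 + 2 * channels n * block n j" by (cases "t0 + 2 * channels n * block n j \<le> t") simp_all
    then show "t \<in> {t0..<t0 + 2 * channels n * block n j}" using t0(2)[OF t] by simp
  qed
  then have "card (gossiping N (scc z)) \<le> 2 * channels n * block n j"
    using card_mono[of "{t0..<t0 + 2 * channels n * block n j}" "gossiping N (scc z)"] by simp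
  also have "\<dots> \<le> 2 * channels n * (3073 * (2 * s) * ((lg n)\<^sup>2 * rt n + (lg n) ^ 4))"
    using block_le[of n j] j(2) by (meson le_trans mult_le_mono1 mult_le_mono2)
  finally show ?thesis by (simp add: s_def mult_ac)
qed

text \<open>Every step before completion is crowded at one of the levels or belongs to a gossiping
  component. Components are disjoint, so their linear costs add up to a multiple of
  \<open>n\<close>.\<close>

theorem incomplete_time_bound:
  assumes v: "v < n" "since (st (n + N) v) = None"
  shows "N \<le> 50448 * n * ((lg n) ^ 3 * rt n + (lg n) ^ 5)"
proof -
  define L where "L = lg n"
  have L: "1 \<le> L" using lg_pos[of n] by (simp add: L_def)
  define I where "I = {i. i \<le> L \<and> (i = 0 \<or> strong_len n (i - 1) \<le> n)}"
  define SS where "SS = scc ` {..<n}"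
  have finI: "finite I" and finS: "finite SS" by (simp_all add: I_def SS_def)
  have "{n..<n + N} \<subseteq> (\<Union>i\<in>I. crowded N i) \<union> (\<Union>A\<in>SS. gossiping N A)"
  proof
    fix t assume t: "t \<in> {n..<n + N}"
    then have "since (st t v) = None" using incomplete_before[OF v(2)] by simp
    from crowd_or_ready[OF _ v(1) this] t
    show "t \<in> (\<Union>i\<in>I. crowded N i) \<union> (\<Union>A\<in>SS. gossiping N A)"
      by (auto simp: I_def SS_def L_def crowded_def gossiping_def)
  qed
  moreover have "finite ((\<Union>i\<in>I. crowded N i) \<union> (\<Union>A\<in>SS. gossiping N A))"
    using finI finS by (auto simp: crowded_def gossiping_def)
  ultimately have "card {n..<n + N} \<le> card ((\<Union>i\<in>I. crowded N i) \<union> (\<Union>A\<in>SS. gossiping N A))"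
    by (intro card_mono)
  also have "\<dots> \<le> card (\<Union>i\<in>I. crowded N i) + card (\<Union>A\<in>SS. gossiping N A)" by (rule card_Un_le)
  also have "\<dots> \<le> (\<Sum>i\<in>I. card (crowded N i)) + (\<Sum>A\<in>SS. card (gossiping N A))"
    by (intro add_mono card_UN_le finI finS)
  also have "\<dots> \<le> (\<Sum>i\<in>I. 160 * n * channels n * L * rt n) +
      (\<Sum>A\<in>SS. 12292 * channels n * (L\<^sup>2 * rt n + L ^ 4) * card A)"
    by (intro add_mono sum_mono) (auto simp: I_def SS_def L_def intro!: card_crowded_le card_gossiping_le)
  also have "\<dots> = card I * (160 * n * channels n * L * rt n) +
      12292 * channels n * (L\<^sup>2 * rt n + L ^ 4) * (\<Sum>A\<in>SS. card A)"
    by (simp add: sum_distrib_left)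
  also have "(\<Sum>A\<in>SS. card A) = card (\<Union>SS)"
  proof (rule card_Union_disjoint[symmetric])
    show "pairwise disjnt SS"
      unfolding pairwise_def SS_def disjnt_def using scc_eq by blast
    show "finite A" if "A \<in> SS" for A using that finite_scc by (auto simp: SS_def)
  qed
  also have "\<Union>SS = {..<n}" using scc_subset self_in_scc by (auto simp: SS_def)
  also have "card I * (160 * n * channels n * L * rt n) \<le> (2 * L) * (160 * n * (4 * L) * L * rt n)"
  proof (intro mult_le_mono order_refl)
    have "card I \<le> card {..L}" by (intro card_mono) (auto simp: I_def)
    then show "card I \<le> 2 * L" using L by simp
    show "channels n \<le> 4 * L" using L by (simp add: channels_def L_def)
  qed
  also have "12292 * channels n * (L\<^sup>2 * rt n + L ^ 4) * card {..<n} \<le> 12292 * (4 * L) * (L\<^sup>2 * rt n + L ^ 4) * n"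
    using L by (intro mult_le_mono order_refl) (simp_all add: channels_def L_def)
  \<comment> \<open>The constant is \<open>2 * 160 * 4 + 12292 * 4\<close>.\<close>
  also have "(2 * L) * (160 * n * (4 * L) * L * rt n) + 12292 * (4 * L) * (L\<^sup>2 * rt n + L ^ 4) * n
      \<le> 50448 * n * (L ^ 3 * rt n + L ^ 5)"
  proof -
    have "L ^ 5 = L * L ^ 4" by (simp flip: power_Suc)
    then show ?thesis by (simp add: algebra_simps power2_eq_square power3_eq_cube power4_eq_xxxx)
  qed
  finally show ?thesis by (simp add: L_def)
qed

end

section \<open>Asymptotics and conclusion\<close>

definition deadline :: "nat \<Rightarrow> nat" where
  "deadline n = n + (50448 * n * ((lg n) ^ 3 * rt n + (lg n) ^ 5) + 1)"

text \<open>From 3 on, \<open>ln (real n)\<close> is at least 1 and absorbs the successor in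
  \<open>lg\<close>; the rest of the constant comes from \<open>1 / 2 \<le> ln 2\<close>.\<close>

lemma lg_le_ln:
  assumes "3 \<le> n"
  shows "real (lg n) \<le> 3 * ln (real n)"
proof -
  have "real (floor_log n) \<le> log 2 n"
    using assms by (simp add: floor_log_altdef)
  also have "\<dots> \<le> 2 * ln (real n)"
  proof -
    have "1 / 2 \<le> ln (2::real)" using ln_le_minus_one[of "1 / 2 :: real"] by (simp add: ln_div)
    then have "ln (real n) * 1 \<le> ln (real n) * (2 * ln 2)" using assms by (intro mult_left_mono) auto
    then show ?thesis by (simp add: log_def field_simps)
  qed
  finally have "real (floor_log n) \<le> 2 * ln (real n)" .
  moreover have "1 \<le> ln (real n)"
    using assms exp_le ln_ge_iff[of "real n" 1] by simp
  ultimately show ?thesis by (simp add: lg_def)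
qed

lemma rt_le_sqrt:
  assumes "1 \<le> n"
  shows "real (rt n) \<le> 2 * sqrt (real n)"
proof -
  have "real (floor_sqrt n) \<le> sqrt (real n)"
    by (rule real_le_rsqrt) (simp flip: of_nat_power)
  moreover have "1 \<le> sqrt (real n)" using assms by simp
  ultimately show ?thesis unfolding rt_def by linarith
qed

lemma deadline_bigo: "(\<lambda>n. real (deadline n)) \<in> O(\<lambda>n. real n powr (3 / 2) * ln (real n) ^ 3)"
proof -
  have "eventually (\<lambda>n. norm (real (deadline n)) \<le> norm
      (real n + 50448 * real n * (27 * ln (real n) ^ 3 * (2 * sqrt (real n)) + 243 * ln (real n) ^ 5) + 1)) sequentially"
    using eventually_ge_at_top[of 3]
  proof eventually_elim
    case (elim n)
    have "real (lg n) ^ 3 \<le> (3 * ln (real n)) ^ 3" "real (lg n) ^ 5 \<le> (3 * ln (real n)) ^ 5"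
      using lg_le_ln[OF elim] by (intro power_mono; simp)+
    then have p: "real (lg n) ^ 3 \<le> 27 * ln (real n) ^ 3" "real (lg n) ^ 5 \<le> 243 * ln (real n) ^ 5"
      by (simp_all add: power_mult_distrib)
    have ln: "0 \<le> ln (real n)" using elim by simp
    have "real (lg n) ^ 3 * real (rt n) + real (lg n) ^ 5 \<le>
        27 * ln (real n) ^ 3 * (2 * sqrt (real n)) + 243 * ln (real n) ^ 5"
      using p rt_le_sqrt[of n] elim ln by (intro add_mono mult_mono) auto
    then have "50448 * real n * (real (lg n) ^ 3 * real (rt n) + real (lg n) ^ 5) \<le>
        50448 * real n * (27 * ln (real n) ^ 3 * (2 * sqrt (real n)) + 243 * ln (real n) ^ 5)"
      by (intro mult_left_mono) auto
    then show ?case using ln by (simp add: deadline_def)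
  qed
  then have "(\<lambda>n. real (deadline n)) \<in> O(\<lambda>n. real n + 50448 * real n *
      (27 * ln (real n) ^ 3 * (2 * sqrt (real n)) + 243 * ln (real n) ^ 5) + 1)"
    by (rule landau_o.big_mono)
  also have "(\<lambda>n. real n + 50448 * real n * (27 * ln (real n) ^ 3 * (2 * sqrt (real n)) + 243 * ln (real n) ^ 5) + 1)
      \<in> O(\<lambda>n. real n powr (3 / 2) * ln (real n) ^ 3)"
    by real_asymp
  finally show ?thesis .
qed

theorem theorem2:
  "\<exists>(P :: protocol) (T :: nat \<Rightarrow> nat).
     valid_protocol P \<and>
     (\<lambda>n. real (T n)) \<in> O(\<lambda>n. real n powr (3 / 2) * ln (real n) ^ 3) \<and>
     (\<forall>(n :: nat) (E :: (nat \<times> nat) set) (t :: nat).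
        E \<subseteq> {..<n} \<times> {..<n} \<and> t < n \<and> (\<forall>v<n. (v, t) \<in> E\<^sup>*) \<longrightarrow>
        gathering_completed P n E t (T n))"
proof (intro exI[of _ gather] exI[of _ deadline] conjI allI impI)
  fix n t :: nat and E :: "(nat \<times> nat) set"
  assume *: "E \<subseteq> {..<n} \<times> {..<n} \<and> t < n \<and> (\<forall>v<n. (v, t) \<in> E\<^sup>*)"
  interpret network n E using * by unfold_locales auto
  have "since (st (deadline n) t) \<noteq> None"
    \<comment> \<open>The extra step in \<open>deadline\<close> exceeds the bound, so being still
      incomplete is contradictory.\<close>
    using incomplete_time_bound[of t "50448 * n * ((lg n) ^ 3 * rt n + (lg n) ^ 5) + 1"] *
    by (auto simp: deadline_def)
  then show "gathering_completed gather n E t (deadline n)"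
    using * by (intro gathering_completed_if_since) auto
qed (rule valid_gather, rule deadline_bigo)

end
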